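(* Let $a\in(1/2,1)$. For every $x\in(0,1/\rho_a)$, one has $$M(x)=\left(\frac{G(x)}{x}\right)^{\frac1a}\left(G(x)+\sqrt{1+G(x)^2}\right).$$
   Context: Let $m_0=m_1=1$ and, for $n\ge2$, $m_n=\dfrac{1}{na-c_n}\sum_{i=1}^{n-1}c_i m_i m_{n-i}$, where $c_i=1$ for even $i$ and $c_i=a$ for odd $i$. Set $M(x)=\sum_{n\ge0}m_n x^n$ (this series is known to have a positive radius of convergence). Let $$\rho_a=\left(\frac{1}{\sqrt\pi}\,\Gamma\!\left(\frac12+\frac1{2a}\right)\Gamma\!\left(1-\frac1{2a}\right)\right)^a,\qquad F(x)=\frac1a\int_x^\infty\frac{du}{u^{1+1/a}\sqrt{1+u^2}}\quad(x>0),$$ where $\Gamma$ is Euler's Gamma function. $F$ is a decreasing bijection of $(0,\infty)$ onto itself; $F^{-1}$ denotes its compositional inverse, and $G(x)=F^{-1}\big(x^{-1/a}-\rho_a^{1/a}\big)$ for $x\in(0,1/\rho_a)$. *)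

theory Defs
  imports "HOL-Analysis.Analysis"
begin

definition c :: "real \<Rightarrow> nat \<Rightarrow> real" where
  "c a i = (if even i then 1 else a)"

function m :: "real \<Rightarrow> nat \<Rightarrow> real" where
  "m a n = (if n \<le> 1 then 1
            else 1 / (real n * a - c a n) * (\<Sum>i=1..<n. c a i * m a i * m a (n - i)))"
  by pat_completeness auto
termination
  by (relation "Wellfounded.measure snd") auto

text \<open>The unrestricted recursion equation would loop as a rewrite rule.\<close>
declare m.simps [simp del]

text \<open>The value is meaningful only where the series converges.\<close>
definition M :: "real \<Rightarrow> real \<Rightarrow> real" where
  "M a x = (\<Sum>n. m a n * x ^ n)"

definition rho :: "real \<Rightarrow> real" where
  "rho a = (1 / sqrt pi * Gamma (1 / 2 + 1 / (2 * a)) * Gamma (1 - 1 / (2 * a))) powr a"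

text \<open>Only used for \<open>x > 0\<close>, where the integrand is continuous and absolutely integrable.\<close>
definition F :: "real \<Rightarrow> real \<Rightarrow> real" where
  "F a x = 1 / a * integral {x..} (\<lambda>u. 1 / (u powr (1 + 1 / a) * sqrt (1 + u\<^sup>2)))"

text \<open>\<open>F a\<close> is a bijection of the positive half-line onto itself; its inverse is taken there.\<close>
definition G :: "real \<Rightarrow> real \<Rightarrow> real" where
  "G a x = the_inv_into {0<..} (F a) (x powr (- 1 / a) - rho a powr (1 / a))"

end

(* Write M = 1 + e + o with e, o the even (n >= 2) and odd parts, and s = 1/a. The recursion says
     a x e' = e + e^2 + a o^2,   a x o' = a o + (1 + a) e o.
   These equations keep ((1 + e)^2 - o^2) (o/x)^(-2/(1+a)) constant, equal to 1. Hence with K = (o/x)^(1/(1+a)) and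
   H = o/K one gets 1 + e = K sqrt(1 + H^2), H = x K^a and x H' = (1 + e) H, which integrates to
   F(H) + rho^s = x^(-s), i.e. H = G.
   Convergence on all of (0, 1/rho) comes from a majorant instead of complex analysis: the explicit candidate, which is
   parametrised by h through x^(-s) = F(h) + rho^s, solves the same equations, and truncations of the
   two series satisfy them with <= in place of =. As the coefficients are nonnegative, the right-hand sides are
   monotone, and induction on the truncation order bounds all partial sums by the candidate. *)
theory Submission imports Defs "HOL-Real_Asymp.Real_Asymp" begin

section \<open>The function F and its Beta integral\<close>

text \<open>The origin is a singular point of the system: linearised there, the even equation has
  the solution x^s and the odd one x, so initial conditions have to be put on x^(-s) e and o/x. They
  make sense because e starts at x^2 and s < 2; the same inequality makes the Beta integral
  converge. The constant comes from here too: F(h) = h^(-s) - rho^s + o(1) as h tends to 0, and any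
  constant other than rho^s in x^(-s) = F(h) + rho^s would add a multiple of x^s to e. The obstacle
  is that the differential equations speak only where the series are known to converge, while the
  claim reaches up to 1/rho, the value of x at which h becomes infinite. The candidate exists on the
  whole interval independently of the series, so bounding truncations by it settles convergence
  before anything is integrated. The conserved quantity comes from two logarithmic derivatives:
  those of (1 + e)^2 - o^2 and of o/x are 2 e / (a x) and (1 + a) e / (a x).\<close>

definition Beta_integrand :: "real \<Rightarrow> real \<Rightarrow> real" where
  "Beta_integrand s t = t powr ((1 - s / 2) - 1) * (1 - t) powr ((s + 1) / 2 - 1)"

text \<open>Integration by parts in \<open>F\<close>, followed by the substitution \<open>t = u\<^sup>2 / (1 + u\<^sup>2)\<close>, gives
  \<open>F a = Phi (1 / a) - rho a powr (1 / a)\<close>. Unlike \<open>F\<close>, \<open>Phi\<close> has no constant term at \<open>0\<close>.\<close>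
definition Phi :: "real \<Rightarrow> real \<Rightarrow> real" where
  "Phi s h = h powr (- s) / sqrt (1 + h\<^sup>2)
     + 1 / 2 * integral {0..h\<^sup>2 / (1 + h\<^sup>2)} (Beta_integrand s)"

lemma Beta_integrand_has_integral:
  assumes "0 < s" "s < 2"
  shows "(Beta_integrand s has_integral Beta (1 - s / 2) ((s + 1) / 2)) {0..1}"
  unfolding Beta_integrand_def[abs_def] using assms by (intro has_integral_Beta_real) auto

text \<open>Continuity of the indefinite integral extends to both end points, where the integrand
  itself may blow up; hence the limit \<open>l\<close> may be 0 or 1.\<close>

lemma Beta_integral_tendsto:
  assumes s: "0 < s" "s < 2" and f: "(f \<longlongrightarrow> l) fl" "l \<in> {0..1}" "eventually (\<lambda>x. f x \<in> {0..1}) fl"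
  shows "((\<lambda>x. integral {0..f x} (Beta_integrand s)) \<longlongrightarrow> integral {0..l} (Beta_integrand s)) fl"
proof -
  have "continuous_on {0..1} (\<lambda>u. integral {0..u} (Beta_integrand s))"
    using Beta_integrand_has_integral[OF s] by (intro indefinite_integral_continuous_1) blast
  from continuous_on_tendsto_compose[OF this f] show ?thesis .
qed

lemma Beta_integral_has_derivative:
  assumes s: "0 < s" "s < 2" and t: "0 < t" "t < 1"
  shows "((\<lambda>u. integral {0..u} (Beta_integrand s)) has_real_derivative Beta_integrand s t) (at t)"
proof -
  have int: "Beta_integrand s integrable_on {0..1}"
    using Beta_integrand_has_integral[OF s] by blast
  have cont: "continuous (at t within {0..1} - {}) (Beta_integrand s)"
    unfolding Beta_integrand_def[abs_def] using t by (intro continuous_intros) auto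
  have "((\<lambda>u. integral {0..u} (Beta_integrand s)) has_vector_derivative Beta_integrand s t)
      (at t within {0..1} - {})"
    by (rule integral_has_vector_derivative_continuous_at[OF int _ _ cont]) (use t in auto)
  moreover have "at t within {0..1} = at t"
    using t by (intro at_within_interior) auto
  ultimately show ?thesis by (simp add: has_real_derivative_iff_has_vector_derivative)
qed

lemma Beta_integrand_subst:
  assumes "h > 0"
  shows "Beta_integrand s (h\<^sup>2 / (1 + h\<^sup>2)) = h powr (- s) * sqrt (1 + h\<^sup>2)"
proof -
  have p: "1 + h\<^sup>2 > 0" by (simp add: add_pos_nonneg)
  have e: "1 - h\<^sup>2 / (1 + h\<^sup>2) = 1 / (1 + h\<^sup>2)" using p by (simp add: field_simps)
  have h2: "h\<^sup>2 = h powr 2" using assms by simp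
  have "(h\<^sup>2) powr (- s / 2) = h powr (- s)"
    unfolding h2 powr_powr by simp
  then have "(h\<^sup>2 / (1 + h\<^sup>2)) powr (- s / 2) = h powr (- s) * (1 + h\<^sup>2) powr (s / 2)"
    using p by (simp add: powr_divide powr_minus_divide)
  moreover have "(1 / (1 + h\<^sup>2)) powr ((s - 1) / 2) = (1 + h\<^sup>2) powr (- (s - 1) / 2)"
    using p powr_minus_divide[of "1 + h\<^sup>2" "(s - 1) / 2"]
    by (simp only: powr_divide minus_divide_left powr_one_eq_one)
  moreover have "(1 + h\<^sup>2) powr (s / 2) * (1 + h\<^sup>2) powr (- (s - 1) / 2) = sqrt (1 + h\<^sup>2)"
  proof -
    have "s / 2 + - (s - 1) / 2 = 1 / 2" by (simp add: field_simps)
    then show ?thesis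
      using p by (simp only: powr_add[symmetric] powr_half_sqrt less_imp_le)
  qed
  ultimately show ?thesis
    by (simp add: Beta_integrand_def e diff_divide_distrib[symmetric] mult.assoc)
qed

text \<open>The Beta term contributes h^(1-s) / (1 + h^2)^(3/2), which cancels what differentiating
  the square root produces in the boundary term. What remains is -s times the integrand of
  \<open>F\<close>.\<close>

lemma Phi_has_derivative:
  assumes s: "0 < s" "s < 2" and h: "h > 0"
  shows "(Phi s has_real_derivative - (s * h powr (- s - 1) / sqrt (1 + h\<^sup>2))) (at h)"
proof -
  let ?q = "sqrt (1 + h\<^sup>2)"
  have p: "1 + h\<^sup>2 > 0" by (simp add: add_pos_nonneg)
  have q: "?q > 0" "?q * ?q = 1 + h\<^sup>2" using p by auto
  have t: "0 < h\<^sup>2 / (1 + h\<^sup>2)" "h\<^sup>2 / (1 + h\<^sup>2) < 1" using h p by auto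
  have d1: "((\<lambda>h. h\<^sup>2 / (1 + h\<^sup>2)) has_real_derivative 2 * h / (1 + h\<^sup>2)\<^sup>2) (at h)"
    using p by (auto intro!: derivative_eq_intros simp: field_simps power2_eq_square)
  have d2: "((\<lambda>h. integral {0..h\<^sup>2 / (1 + h\<^sup>2)} (Beta_integrand s)) has_real_derivative
      (h powr (- s) * ?q) * (2 * h / (1 + h\<^sup>2)\<^sup>2)) (at h)"
    using DERIV_chain2[OF Beta_integral_has_derivative[OF s t] d1]
    by (simp add: Beta_integrand_subst[OF h])
  have d3: "((\<lambda>h. h powr (- s) / sqrt (1 + h\<^sup>2)) has_real_derivative
      (- s * h powr (- s - 1) * ?q - h powr (- s) * (h / ?q)) / (?q * ?q)) (at h)"
  proof -
    have "((\<lambda>h. sqrt (1 + h\<^sup>2)) has_real_derivative h / ?q) (at h)"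
      using p by (auto intro!: derivative_eq_intros simp: field_simps)
    from DERIV_divide[OF has_real_derivative_powr[OF h, of "- s"] this] show ?thesis
      using q by simp
  qed
  have e: "h powr (- s) = h * h powr (- s - 1)"
    using h powr_add[of h 1 "- s - 1"] by simp
  \<comment> \<open>Square root and power are replaced by variables, so that the cancellation
    becomes an identity of rational functions.\<close>
  have e2: "(- s * P * r - (h * P) * (h / r)) / (r * r) + 1 / 2 * ((h * P * r) * (2 * h / (r * r)\<^sup>2))
      = - (s * P / r)" if "r > 0" for P r :: real
    using that by (simp add: field_simps power2_eq_square)
  show ?thesis
    using DERIV_add[OF d3 DERIV_cmult[OF d2, of "1 / 2"]] e2[OF q(1), of "h powr (- s - 1)"]
    unfolding Phi_def[abs_def] q(2) e by simp
qed

lemma Phi_ge: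
  assumes s: "0 < s" "s < 2"
  shows "Phi s h \<ge> h powr (- s) / sqrt (1 + h\<^sup>2)"
proof -
  have "Beta_integrand s integrable_on {0..h\<^sup>2 / (1 + h\<^sup>2)}"
    by (rule integrable_on_subinterval[OF has_integral_integrable[OF Beta_integrand_has_integral[OF s]]])
       (auto simp: divide_le_eq_1 add_pos_nonneg)
  then have "integral {0..h\<^sup>2 / (1 + h\<^sup>2)} (Beta_integrand s) \<ge> 0"
    by (rule integral_nonneg) (auto simp: Beta_integrand_def)
  then show ?thesis unfolding Phi_def by simp
qed

lemma Phi_pos: "0 < s \<Longrightarrow> s < 2 \<Longrightarrow> h > 0 \<Longrightarrow> Phi s h > 0"
  by (rule less_le_trans[OF _ Phi_ge]) (auto simp: add_pos_nonneg)

text \<open>The boundary term differs from h^(-s) by O(h^(2-s)) and the range of the Beta integral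
  shrinks to a point, so no constant term survives.\<close>

lemma Phi_asymp_0:
  assumes s: "0 < s" "s < 2"
  shows "((\<lambda>h. Phi s h - h powr (- s)) \<longlongrightarrow> 0) (at_right 0)"
proof -
  have l: "((\<lambda>h::real. h\<^sup>2 / (1 + h\<^sup>2)) \<longlongrightarrow> 0) (at_right 0)" by real_asymp
  have "((\<lambda>h. integral {0..h\<^sup>2 / (1 + h\<^sup>2)} (Beta_integrand s)) \<longlongrightarrow> integral {0..0} (Beta_integrand s))
      (at_right 0)"
    by (rule Beta_integral_tendsto[OF s l])
       (auto simp: eventually_at_filter divide_le_eq_1 add_pos_nonneg intro!: always_eventually)
  moreover have "((\<lambda>h. h powr (- s) / sqrt (1 + h\<^sup>2) - h powr (- s)) \<longlongrightarrow> 0) (at_right 0)"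
    using s by real_asymp
  ultimately show ?thesis
    using tendsto_add[OF _ tendsto_mult_left[where c = "1 / 2"]] unfolding Phi_def
    by (fastforce simp: algebra_simps)
qed

lemma Phi_at_top:
  assumes s: "0 < s" "s < 2"
  shows "(Phi s \<longlongrightarrow> 1 / 2 * Beta (1 - s / 2) ((s + 1) / 2)) at_top"
proof -
  have l: "((\<lambda>h::real. h\<^sup>2 / (1 + h\<^sup>2)) \<longlongrightarrow> 1) at_top" by real_asymp
  have "((\<lambda>h. integral {0..h\<^sup>2 / (1 + h\<^sup>2)} (Beta_integrand s)) \<longlongrightarrow> integral {0..1} (Beta_integrand s))
      at_top"
    by (rule Beta_integral_tendsto[OF s l])
       (auto simp: divide_le_eq_1 add_pos_nonneg intro!: always_eventually)
  moreover have "((\<lambda>h. h powr (- s) / sqrt (1 + h\<^sup>2)) \<longlongrightarrow> 0) at_top"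
    using s by real_asymp
  ultimately show ?thesis
    unfolding Phi_def[abs_def] using integral_unique[OF Beta_integrand_has_integral[OF s]]
    using tendsto_add[OF _ tendsto_mult_left[where c = "1 / 2"]] by fastforce
qed

lemma Phi_strict_antimono:
  assumes s: "0 < s" "s < 2" and "0 < h" "h < k"
  shows "Phi s k < Phi s h"
proof (rule DERIV_neg_imp_decreasing[OF \<open>h < k\<close>])
  fix u assume "h \<le> u" "u \<le> k"
  then have "u > 0" using assms by simp
  then show "\<exists>y. DERIV (Phi s) u :> y \<and> y < 0"
    using Phi_has_derivative[OF s \<open>u > 0\<close>] s
    by (intro exI[of _ "- (s * u powr (- s - 1) / sqrt (1 + u\<^sup>2))"] conjI) (auto simp: add_pos_nonneg)
qed

section \<open>The constant rho as a Beta value, and the inversion of F\<close>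

lemma rho_base_pos:
  assumes a: "1 / 2 < a"
  shows "1 / sqrt pi * Gamma (1 / 2 + 1 / (2 * a)) * Gamma (1 - 1 / (2 * a)) > 0"
proof -
  have "1 / 2 + 1 / (2 * a) > 0" "1 - 1 / (2 * a) > 0" using a by (auto simp: field_simps)
  then show ?thesis by (intro mult_pos_pos Gamma_real_pos) auto
qed

lemma rho_pos: "1 / 2 < a \<Longrightarrow> rho a > 0"
  unfolding rho_def using rho_base_pos by (metis powr_gt_zero less_irrefl)

text \<open>The two Beta arguments add up to 3/2, and Gamma(3/2) = sqrt pi / 2 accounts for both the
  factor 1/2 and the 1 / sqrt pi in \<open>rho\<close>.\<close>

lemma rho_powr_inverse:
  assumes a: "1 / 2 < a"
  shows "rho a powr (1 / a) = 1 / 2 * Beta (1 - 1 / a / 2) ((1 / a + 1) / 2)"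
proof -
  let ?c = "1 / sqrt pi * Gamma (1 / 2 + 1 / (2 * a)) * Gamma (1 - 1 / (2 * a))"
  have "rho a powr (1 / a) = ?c powr (a * (1 / a))"
    unfolding rho_def powr_powr ..
  also have "a * (1 / a) = 1" using a by simp
  also have "?c powr 1 = ?c" by (rule powr_one[OF less_imp_le[OF rho_base_pos[OF a]]])
  finally have r: "rho a powr (1 / a) = ?c" .
  have g: "Gamma (3 / 2 :: real) = sqrt pi / 2"
  proof -
    have "(1 / 2 :: real) \<notin> \<int>\<^sub>\<le>\<^sub>0" by (auto dest: nonpos_Ints_nonpos)
    from Gamma_plus1[OF this] show ?thesis by (simp add: Gamma_one_half_real)
  qed
  have e: "1 - 1 / a / 2 + (1 / a + 1) / 2 = 3 / 2" using a by (simp add: field_simps)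
  have e': "1 / 2 + 1 / (2 * a) = (1 / a + 1) / 2" "1 - 1 / (2 * a) = 1 - 1 / a / 2"
    using a by (auto simp: field_simps)
  show ?thesis unfolding Beta_def r e e' g by simp
qed

lemma Phi_at_top_rho:
  assumes a: "1 / 2 < a"
  shows "(Phi (1 / a) \<longlongrightarrow> rho a powr (1 / a)) at_top"
  unfolding rho_powr_inverse[OF a] by (rule Phi_at_top) (use a in \<open>auto simp: field_simps\<close>)

lemma F_eq_Phi:
  assumes a: "1 / 2 < a" and h: "h > 0"
  shows "F a h = Phi (1 / a) h - rho a powr (1 / a)"
proof -
  define s where "s = 1 / a"
  have s: "0 < s" "s < 2" using a by (auto simp: s_def field_simps)
  let ?f = "\<lambda>u. 1 / (u powr (1 + 1 / a) * sqrt (1 + u\<^sup>2))"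
  have der: "((\<lambda>u. - Phi s u / s) has_real_derivative ?f u) (at u)" if "u > 0" for u
  proof -
    have "- (s * u powr (- s - 1) / sqrt (1 + u\<^sup>2)) = - s * ?f u"
    proof -
      have "- s - 1 = - (1 + 1 / a)" by (simp add: s_def)
      then have "u powr (- s - 1) = 1 / u powr (1 + 1 / a)" by (simp only: powr_minus_divide)
      then show ?thesis by simp
    qed
    with Phi_has_derivative[OF s that]
    have "(Phi s has_real_derivative - s * ?f u) (at u)" by simp
    from DERIV_cdivide[OF DERIV_minus[OF this], of s] show ?thesis using s by simp
  qed
  have int: "(?f has_integral (- Phi s y / s) - (- Phi s h / s)) {h..y}" if "h \<le> y" for y
  proof (rule fundamental_theorem_of_calculus[OF that])
    fix u assume "u \<in> {h..y}"
    with h der[of u] show "((\<lambda>u. - Phi s u / s) has_vector_derivative ?f u) (at u within {h..y})"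
      by (simp only: has_real_derivative_iff_has_vector_derivative has_vector_derivative_at_within
          atLeastAtMost_iff less_le_trans[OF h])
  qed
  \<comment> \<open>The integrand is nonnegative, so the limit of the integrals over
    \<open>{h..y}\<close> is the integral over the half-line; \<open>rho a powr (1 / a)\<close>
    enters as the limit of \<open>Phi\<close> at infinity.\<close>
  have "(?f has_integral (Phi s h - rho a powr (1 / a)) / s) {h..}"
  proof (rule has_integral_to_inf)
    show "?f integrable_on {h..y}" for y
      using int[of y] by (cases "h \<le> y") (auto intro!: integrable_on_empty)
    have "((\<lambda>y. (- Phi s y / s) - (- Phi s h / s)) \<longlongrightarrow> - (rho a powr (1 / a)) / s - (- Phi s h / s)) at_top"
      using Phi_at_top_rho[OF a] s by (intro tendsto_intros) (auto simp: s_def)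
    then have "((\<lambda>y. integral {h..y} ?f) \<longlongrightarrow> - (rho a powr (1 / a)) / s - (- Phi s h / s)) at_top"
      by (rule tendsto_cong[THEN iffD1, rotated])
         (rule eventually_at_top_linorderI[of h], subst integral_unique[OF int], auto)
    then show "((\<lambda>y. integral {h..y} ?f) \<longlongrightarrow> (Phi s h - rho a powr (1 / a)) / s) at_top"
      by (simp add: diff_divide_distrib)
  qed auto
  from integral_unique[OF this] show ?thesis
    unfolding F_def using s by (simp add: s_def)
qed

lemma Phi_inj:
  assumes "0 < s" "s < 2" "h > 0" "k > 0" "Phi s h = Phi s k"
  shows "h = k"
  using Phi_strict_antimono[OF assms(1,2), of h k] Phi_strict_antimono[OF assms(1,2), of k h] assms(3-)
  by (cases h k rule: linorder_cases) auto

text \<open>Adding \<open>rho a powr (1 / a)\<close> on both sides turns the equation for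
  \<open>F\<close> into one for \<open>Phi\<close>; injectivity then identifies the value of
  \<open>the_inv_into\<close>.\<close>

lemma G_eqI:
  assumes a: "1 / 2 < a" and h: "h > 0" and eq: "Phi (1 / a) h = x powr (- 1 / a)"
  shows "G a x = h"
proof -
  have s: "0 < 1 / a" "1 / a < 2" using a by (auto simp: field_simps)
  have "inj_on (F a) {0<..}"
    by (rule inj_onI) (auto simp: F_eq_Phi[OF a] dest: Phi_inj[OF s])
  moreover have "x powr (- 1 / a) - rho a powr (1 / a) = F a h"
    using F_eq_Phi[OF a h] eq by simp
  ultimately show ?thesis unfolding G_def using h by (simp add: the_inv_into_f_f)
qed

lemma Phi_surj:
  assumes a: "1 / 2 < a" and y: "y > rho a powr (1 / a)"
  obtains h where "h > 0" "Phi (1 / a) h = y"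
proof -
  define s where "s = 1 / a"
  have s: "0 < s" "s < 2" using a by (auto simp: s_def field_simps)
  have "filterlim (\<lambda>h. h powr - s) at_top (at_right 0)" using s by real_asymp
  from filterlim_tendsto_add_at_top[OF Phi_asymp_0[OF s] this]
  have "filterlim (Phi s) at_top (at_right 0)" by simp
  then have "\<forall>\<^sub>F h in at_right 0. Phi s h \<ge> y" by (simp add: filterlim_at_top)
  then obtain b where b: "b > 0" "\<And>h. 0 < h \<Longrightarrow> h < b \<Longrightarrow> Phi s h \<ge> y"
    by (auto simp: eventually_at_right_field)
  have "(Phi s \<longlongrightarrow> rho a powr (1 / a)) at_top"
    using Phi_at_top_rho[OF a] by (simp add: s_def)
  from order_tendstoD(2)[OF this y] obtain k where k: "\<And>h. h \<ge> k \<Longrightarrow> Phi s h < y"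
    by (auto simp: eventually_at_top_linorder)
  \<comment> \<open>The bound \<open>Phi s h \<ge> y\<close> holds strictly below \<open>b\<close>,
    hence the left end \<open>b / 2\<close>; \<open>max k b\<close> lies to its right and in the
    range where \<open>Phi s h < y\<close>.\<close>
  have "\<exists>h\<ge>b / 2. h \<le> max k b \<and> Phi s h = y"
  proof (rule IVT2)
    show "\<forall>h. b / 2 \<le> h \<and> h \<le> max k b \<longrightarrow> isCont (Phi s) h"
      using b(1) by (auto intro!: DERIV_isCont[OF Phi_has_derivative[OF s]])
  qed (use b(1) in \<open>auto intro: b less_imp_le[OF k]\<close>)
  then obtain h where "h \<ge> b / 2" "Phi s h = y" by blast
  then show ?thesis using that[of h] b(1) by (simp add: s_def)
qed

section \<open>The coefficient recursion\<close>

text \<open>The constant term 1 is left out. Both parts then vanish at index 0, so a full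
  convolution over \<open>i \<le> n\<close> agrees with the inner sum of the recursion and involves
  only coefficients of index below \<open>n\<close>.\<close>

definition even_part :: "real \<Rightarrow> nat \<Rightarrow> real" where
  "even_part a n = (if even n \<and> n \<ge> 2 then m a n else 0)"

definition odd_part :: "real \<Rightarrow> nat \<Rightarrow> real" where
  "odd_part a n = (if odd n then m a n else 0)"

lemma m_split: "m a n = (if n = 0 then 1 else 0) + even_part a n + odd_part a n"
proof (cases "n = 0")
  case False
  then show ?thesis by (cases "n = 1") (auto simp: even_part_def odd_part_def)
qed (simp add: even_part_def odd_part_def m.simps)

text \<open>The critical case is n = 2, where the denominator is 2a - 1.\<close>

lemma m_denominator_pos:
  assumes a: "1 / 2 < a" and n: "2 \<le> n"
  shows "real n * a - c a n > 0"
proof (cases "even n")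
  case True
  have "real n * a \<ge> 2 * a" using n a by (intro mult_right_mono) auto
  then have "real n * a > 1" using a by linarith
  then show ?thesis using True by (simp add: c_def)
next
  case False
  have "real n * a \<ge> 2 * a" using n a by (intro mult_right_mono) auto
  then have "real n * a > a" using a by linarith
  then show ?thesis using False by (simp add: c_def)
qed

lemma m_nonneg:
  assumes a: "1 / 2 < a"
  shows "m a n \<ge> 0"
proof (induction n rule: less_induct)
  case (less n)
  show ?case
  proof (cases "n \<le> 1")
    case False
    have "(\<Sum>i=1..<n. c a i * m a i * m a (n - i)) \<ge> 0"
      using a by (intro sum_nonneg mult_nonneg_nonneg less) (auto simp: c_def)
    with m_denominator_pos[OF a, of n] show ?thesis
      using False by (subst m.simps) simp
  qed (simp add: m.simps)
qed

lemma m_rec: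
  assumes a: "1 / 2 < a" and n: "2 \<le> n"
  shows "(real n * a - c a n) * m a n = (\<Sum>i=1..<n. c a i * m a i * m a (n - i))"
  using m_denominator_pos[OF a n] n by (subst m.simps) simp

lemma even_part_nonneg: "1 / 2 < a \<Longrightarrow> even_part a n \<ge> 0"
  and odd_part_nonneg: "1 / 2 < a \<Longrightarrow> odd_part a n \<ge> 0"
  by (simp_all add: even_part_def odd_part_def m_nonneg)

lemma parts_of_even: "even n \<Longrightarrow> n \<noteq> 0 \<Longrightarrow> even_part a n = m a n" "even n \<Longrightarrow> odd_part a n = 0"
  and parts_of_odd: "odd n \<Longrightarrow> even_part a n = 0" "odd n \<Longrightarrow> odd_part a n = m a n"
  unfolding even_part_def odd_part_def by (auto elim!: evenE)

lemma part_simps [simp]: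
  "even_part a 0 = 0" "even_part a (Suc 0) = 0" "odd_part a 0 = 0" "odd_part a (Suc 0) = 1"
  by (simp_all add: even_part_def odd_part_def m.simps)

lemma sum_atMost_eq_inner:
  fixes f :: "nat \<Rightarrow> real"
  assumes "f 0 = 0" "f n = 0"
  shows "(\<Sum>i\<le>n. f i) = (\<Sum>i=1..<n. f i)"
proof (rule sum.mono_neutral_right)
  show "\<forall>i\<in>{..n} - {1..<n}. f i = 0"
  proof
    fix i assume "i \<in> {..n} - {1..<n}"
    then have "i = 0 \<or> i = n" by auto
    with assms show "f i = 0" by auto
  qed
qed auto

text \<open>For even \<open>n\<close> the indices \<open>i\<close> and \<open>n - i\<close> have
  equal parity, with weight 1 for even and \<open>a\<close> for odd pairs. For all other
  \<open>n\<close> both sides vanish, so the identity can be summed over \<open>n\<close> without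
  exceptional terms.\<close>

lemma even_part_rec:
  assumes a: "1 / 2 < a"
  shows "(a * real n - 1) * even_part a n = (\<Sum>i\<le>n. even_part a i * even_part a (n - i))
           + a * (\<Sum>i\<le>n. odd_part a i * odd_part a (n - i))"
proof -
  let ?t = "\<lambda>i. even_part a i * even_part a (n - i) + a * (odd_part a i * odd_part a (n - i))"
  have r: "(\<Sum>i\<le>n. even_part a i * even_part a (n - i)) + a * (\<Sum>i\<le>n. odd_part a i * odd_part a (n - i))
      = (\<Sum>i=1..<n. ?t i)"
    unfolding sum_distrib_left sum.distrib[symmetric] by (rule sum_atMost_eq_inner) auto
  show ?thesis
  proof (cases "even n \<and> n \<ge> 2")
    case True
    have "(\<Sum>i=1..<n. ?t i) = (\<Sum>i=1..<n. c a i * m a i * m a (n - i))"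
    proof (rule sum.cong)
      fix i assume "i \<in> {1..<n}"
      with True show "?t i = c a i * m a i * m a (n - i)"
        by (cases "even i") (auto simp: parts_of_even parts_of_odd c_def)
    qed simp
    with m_rec[OF a, of n] True show ?thesis
      unfolding r by (simp add: even_part_def c_def mult.commute)
  next
    case False
    have "?t i = 0" if "i \<in> {1..<n}" for i
      using that False by (auto simp: even_part_def odd_part_def)
    then have "(\<Sum>i=1..<n. ?t i) = 0" by (intro sum.neutral) auto
    moreover have "even_part a n = 0" unfolding even_part_def using False by (rule if_not_P)
    ultimately show ?thesis unfolding r by simp
  qed
qed

text \<open>For odd \<open>n\<close> exactly one of \<open>i\<close> and \<open>n - i\<close> is
  even. The two resulting convolutions agree under the reflection of \<open>i\<close> to
  \<open>n - i\<close>, and their weights add up to \<open>1 + a\<close>. At \<open>n = 1\<close>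
  both sides are 0, which leaves the value m_1 = 1 as an initial condition.\<close>

lemma odd_part_rec:
  assumes a: "1 / 2 < a"
  shows "a * (real n - 1) * odd_part a n = (1 + a) * (\<Sum>i\<le>n. even_part a i * odd_part a (n - i))"
proof -
  let ?t = "\<lambda>i. even_part a i * odd_part a (n - i) + a * (odd_part a i * even_part a (n - i))"
  have sw: "(\<Sum>i\<le>n. even_part a i * odd_part a (n - i)) = (\<Sum>i\<le>n. odd_part a i * even_part a (n - i))"
    by (rule sum.reindex_bij_witness[of _ "\<lambda>i. n - i" "\<lambda>i. n - i"]) auto
  have "(1 + a) * (\<Sum>i\<le>n. even_part a i * odd_part a (n - i)) =
    (\<Sum>i\<le>n. even_part a i * odd_part a (n - i)) + a * (\<Sum>i\<le>n. odd_part a i * even_part a (n - i))"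
    by (simp add: sw[symmetric] algebra_simps)
  also have "\<dots> = (\<Sum>i=1..<n. ?t i)"
    unfolding sum_distrib_left sum.distrib[symmetric] by (rule sum_atMost_eq_inner) auto
  finally have r: "(1 + a) * (\<Sum>i\<le>n. even_part a i * odd_part a (n - i)) = (\<Sum>i=1..<n. ?t i)" .
  consider "even n" | "n = 1" | "odd n" "n \<ge> 2" by (cases "n = 1"; cases "n = 0") auto
  then show ?thesis
  proof cases
    case 1
    have "?t i = 0" if "i \<in> {1..<n}" for i
      using that 1 by (auto simp: even_part_def odd_part_def)
    then have "(\<Sum>i=1..<n. ?t i) = 0" by (intro sum.neutral) auto
    then show ?thesis unfolding r using 1 by (simp add: odd_part_def)
  next
    case 3
    have "(\<Sum>i=1..<n. ?t i) = (\<Sum>i=1..<n. c a i * m a i * m a (n - i))"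
    proof (rule sum.cong)
      fix i assume "i \<in> {1..<n}"
      with 3 show "?t i = c a i * m a i * m a (n - i)"
        by (cases "even i") (auto simp: parts_of_even parts_of_odd c_def)
    qed simp
    with m_rec[OF a, of n] 3 show ?thesis
      unfolding r by (simp add: odd_part_def c_def algebra_simps)
  qed (simp add: r)
qed

section \<open>Truncated series and their differential inequalities\<close>

definition psum :: "(nat \<Rightarrow> real) \<Rightarrow> nat \<Rightarrow> real \<Rightarrow> real" where
  "psum p N x = (\<Sum>n<N. p n * x ^ n)"

lemma psum_nonneg: "(\<And>n. p n \<ge> 0) \<Longrightarrow> (x::real) \<ge> 0 \<Longrightarrow> psum p N x \<ge> 0"
  by (simp add: psum_def sum_nonneg)

text \<open>Since \<open>p 0 = q 0 = 0\<close>, only pairs with i, j \<ge> 1 contribute, and i + j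
  \<le> N then forces both below \<open>N\<close>. This shift from \<open>Suc N\<close> to
  \<open>N\<close> is what an induction on the truncation order needs.\<close>

lemma psum_Cauchy_product_le:
  fixes x :: real
  assumes p: "\<And>n. p n \<ge> 0" "p 0 = 0" and q: "\<And>n. q n \<ge> 0" "q 0 = 0" and x: "x \<ge> 0"
  shows "psum (\<lambda>n. \<Sum>i\<le>n. p i * q (n - i)) (Suc N) x \<le> psum p N x * psum q N x"
proof -
  let ?f = "\<lambda>i j. (p i * x ^ i) * (q j * x ^ j)"
  let ?T = "{(i, j). i + j < Suc N}"
  let ?T' = "{(i, j). i + j < Suc N \<and> i \<noteq> 0 \<and> j \<noteq> 0}"
  have fin: "finite ?T"
    by (rule finite_subset[of _ "{..N} \<times> {..N}"]) auto
  have "psum (\<lambda>n. \<Sum>i\<le>n. p i * q (n - i)) (Suc N) x = (\<Sum>n<Suc N. \<Sum>i\<le>n. ?f i (n - i))"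
    unfolding psum_def sum_distrib_right
  proof (intro sum.cong refl)
    fix n i :: nat assume "i \<in> {..n}"
    then have "x ^ n = x ^ i * x ^ (n - i)" by (simp flip: power_add)
    then show "p i * q (n - i) * x ^ n = ?f i (n - i)" by simp
  qed
  also have "\<dots> = (\<Sum>(i, j)\<in>?T. ?f i j)"
    by (rule sum.triangle_reindex[symmetric])
  also have "\<dots> = (\<Sum>(i, j)\<in>?T'. ?f i j)"
    using p(2) q(2) by (intro sum.mono_neutral_right[OF fin]) (auto intro!: gr0I)
  also have "\<dots> \<le> (\<Sum>(i, j)\<in>{..<N} \<times> {..<N}. ?f i j)"
    using p(1) q(1) x by (intro sum_mono2) auto
  also have "\<dots> = psum p N x * psum q N x"
    unfolding psum_def sum_product sum.cartesian_product ..
  finally show ?thesis .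
qed

lemma psum_add: "psum p N x + psum q N x = psum (\<lambda>n. p n + q n) N x"
  and psum_cmult: "r * psum p N x = psum (\<lambda>n. r * p n) N x"
  and psum_diff: "psum p N x - psum q N x = psum (\<lambda>n. p n - q n) N x"
  by (simp_all add: psum_def algebra_simps sum.distrib sum_subtractf sum_distrib_left)

text \<open>The left side is a x d/dx - 1 applied to the truncation at \<open>Suc N\<close>; the
  right side involves only truncations at \<open>N\<close>, which an induction hypothesis can
  bound.\<close>

lemma psum_even_part_le:
  assumes a: "1 / 2 < a" and x: "x \<ge> 0"
  shows "a * psum (\<lambda>n. real n * even_part a n) (Suc N) x - psum (even_part a) (Suc N) x
     \<le> (psum (even_part a) N x)\<^sup>2 + a * (psum (odd_part a) N x)\<^sup>2"
proof -
  have "a * psum (\<lambda>n. real n * even_part a n) (Suc N) x - psum (even_part a) (Suc N) x =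
      psum (\<lambda>n. (a * real n - 1) * even_part a n) (Suc N) x"
    unfolding psum_cmult psum_diff by (simp add: algebra_simps)
  also have "\<dots> = psum (\<lambda>n. \<Sum>i\<le>n. even_part a i * even_part a (n - i)) (Suc N) x
           + a * psum (\<lambda>n. \<Sum>i\<le>n. odd_part a i * odd_part a (n - i)) (Suc N) x"
    unfolding even_part_rec[OF a] psum_cmult psum_add ..
  also have "\<dots> \<le> psum (even_part a) N x * psum (even_part a) N x + a * (psum (odd_part a) N x * psum (odd_part a) N x)"
    using a x by (intro add_mono mult_left_mono psum_Cauchy_product_le)
      (auto simp: even_part_nonneg odd_part_nonneg)
  finally show ?thesis by (simp add: power2_eq_square)
qed

lemma psum_odd_part_le:
  assumes a: "1 / 2 < a" and x: "x \<ge> 0"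
  shows "a * (psum (\<lambda>n. real n * odd_part a n) (Suc N) x - psum (odd_part a) (Suc N) x)
     \<le> (1 + a) * (psum (even_part a) N x * psum (odd_part a) N x)"
proof -
  have "a * (psum (\<lambda>n. real n * odd_part a n) (Suc N) x - psum (odd_part a) (Suc N) x) =
      psum (\<lambda>n. a * (real n - 1) * odd_part a n) (Suc N) x"
    unfolding psum_cmult psum_diff by (simp add: algebra_simps)
  also have "\<dots> = (1 + a) * psum (\<lambda>n. \<Sum>i\<le>n. even_part a i * odd_part a (n - i)) (Suc N) x"
    unfolding odd_part_rec[OF a] psum_cmult ..
  also have "\<dots> \<le> (1 + a) * (psum (even_part a) N x * psum (odd_part a) N x)"
    using a x by (intro mult_left_mono psum_Cauchy_product_le)
      (auto simp: even_part_nonneg odd_part_nonneg)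
  finally show ?thesis .
qed

lemma psum_has_derivative:
  assumes "x \<noteq> 0"
  shows "(psum p N has_real_derivative psum (\<lambda>n. real n * p n) N x / x) (at x)"
proof -
  have "((\<lambda>x. \<Sum>n<N. p n * x ^ n) has_real_derivative (\<Sum>n<N. p n * (real n * x ^ (n - 1)))) (at x)"
    by (intro DERIV_sum DERIV_cmult) (use DERIV_pow[of _ x] in simp)
  moreover have "p n * (real n * x ^ (n - 1)) = real n * p n * x ^ n / x" for n
    using assms by (cases n) auto
  ultimately show ?thesis
    by (simp add: psum_def[abs_def] sum_divide_distrib)
qed

section \<open>The majorant and convergence\<close>

text \<open>At \<open>x = Xfun a h\<close> the candidate solution with \<open>G a x = h\<close> has even part
  \<open>Kfun a h * sqrt (1 + h\<^sup>2)\<close> and odd part \<open>Kfun a h * h\<close>.\<close>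
definition Kfun :: "real \<Rightarrow> real \<Rightarrow> real" where
  "Kfun a h = h powr (1 / a) * Phi (1 / a) h"

definition Xfun :: "real \<Rightarrow> real \<Rightarrow> real" where
  "Xfun a h = Phi (1 / a) h powr (- a)"

lemma inverse_range: "1 / 2 < a \<Longrightarrow> 0 < 1 / a" "1 / 2 < a \<Longrightarrow> 1 / a < (2::real)"
  by (auto simp: field_simps)

lemma Kfun_pos: "1 / 2 < a \<Longrightarrow> h > 0 \<Longrightarrow> Kfun a h > 0"
  and Xfun_pos: "1 / 2 < a \<Longrightarrow> h > 0 \<Longrightarrow> Xfun a h > 0"
  using Phi_pos[OF inverse_range, of a h] by (auto simp: Kfun_def Xfun_def)

lemma Phi_eq_Kfun: "h > 0 \<Longrightarrow> Phi (1 / a) h = Kfun a h * h powr (- (1 / a))"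
  by (simp add: Kfun_def powr_minus)

lemma Xfun_powr:
  assumes "1 / 2 < a" "h > 0"
  shows "Xfun a h powr (- (1 / a)) = Phi (1 / a) h"
proof -
  have "- a * - (1 / a) = 1" using assms by simp
  then show ?thesis
    unfolding Xfun_def powr_powr using Phi_pos[OF inverse_range, of a h] assms by simp
qed

lemma Xfun_eq:
  assumes "1 / 2 < a" "h > 0"
  shows "Xfun a h = h * Kfun a h powr (- a)"
proof -
  have "(h powr (- (1 / a))) powr (- a) = h"
    unfolding powr_powr using assms by simp
  then show ?thesis
    using Kfun_pos[OF assms] by (simp add: Xfun_def Phi_eq_Kfun[OF assms(2)] powr_mult)
qed

lemma Phi_has_derivative':
  assumes a: "1 / 2 < a" and h: "h > 0"
  shows "(Phi (1 / a) has_real_derivative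
           - (1 / a * Phi (1 / a) h / (Kfun a h * h * sqrt (1 + h\<^sup>2)))) (at h)"
proof -
  have "h powr (- (1 / a) - 1) = h powr (- (1 / a)) / h"
    using h by (simp add: powr_diff)
  with Phi_has_derivative[OF inverse_range[OF a] h] show ?thesis
    using Kfun_pos[OF a h] h by (simp add: Phi_eq_Kfun[OF h] mult_ac)
qed

text \<open>With u = \<open>Kfun a h * h * sqrt (1 + h\<^sup>2)\<close> this says that u d/dh is x
  d/dx along the curve x = \<open>Xfun a h\<close>. All derivatives of the candidate are therefore
  written over the denominator u.\<close>

lemma Xfun_has_derivative:
  assumes a: "1 / 2 < a" and h: "h > 0"
  shows "(Xfun a has_real_derivative Xfun a h / (Kfun a h * h * sqrt (1 + h\<^sup>2))) (at h)"
proof -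
  have P: "Phi (1 / a) h > 0" using Phi_pos[OF inverse_range[OF a] h] .
  have "Phi (1 / a) h powr (- a - 1) = Xfun a h / Phi (1 / a) h"
    using P by (simp add: Xfun_def powr_diff)
  then show ?thesis
    using DERIV_chain2[OF has_real_derivative_powr[OF P, of "- a"] Phi_has_derivative'[OF a h]] P a
    unfolding Xfun_def[abs_def] by simp
qed

lemma Kfun_has_derivative:
  assumes a: "1 / 2 < a" and h: "h > 0"
  shows "(Kfun a has_real_derivative
     1 / a * Kfun a h * (Kfun a h * sqrt (1 + h\<^sup>2) - 1) / (Kfun a h * h * sqrt (1 + h\<^sup>2))) (at h)"
proof -
  have q: "sqrt (1 + h\<^sup>2) > 0" by (simp add: add_pos_nonneg)
  have "h powr (1 / a - 1) = h powr (1 / a) / h"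
    using h by (simp add: powr_diff)
  then have e1: "1 / a * h powr (1 / a - 1) * Phi (1 / a) h = 1 / a * Kfun a h / h"
    by (simp add: Kfun_def)
  have e2: "- (1 / a * Phi (1 / a) h / (Kfun a h * h * sqrt (1 + h\<^sup>2))) * h powr (1 / a)
      = - (1 / a * Kfun a h) / (Kfun a h * h * sqrt (1 + h\<^sup>2))"
    by (simp add: Kfun_def)
  have e3: "1 / a * k / h + - (1 / a * k) / (k * h * q) = 1 / a * k * (k * q - 1) / (k * h * q)"
    if "k > 0" "q > 0" for k q :: real using that h a by (simp add: field_simps)
  from DERIV_mult[OF has_real_derivative_powr[OF h, of "1 / a"] Phi_has_derivative'[OF a h]]
  show ?thesis
    unfolding e1 e2 e3[OF Kfun_pos[OF a h] q] Kfun_def[of a, abs_def, symmetric] .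
qed

section \<open>Behaviour at the origin\<close>

lemma Kfun_tendsto_1:
  assumes a: "1 / 2 < a"
  shows "(Kfun a \<longlongrightarrow> 1) (at_right 0)"
proof -
  note s = inverse_range[OF a]
  have "((\<lambda>h. h powr (1 / a)) \<longlongrightarrow> 0) (at_right 0)"
    using s(1) by real_asymp
  from tendsto_add[OF tendsto_mult[OF this Phi_asymp_0[OF s]] tendsto_const[of 1]]
  have "((\<lambda>h. h powr (1 / a) * (Phi (1 / a) h - h powr - (1 / a)) + 1) \<longlongrightarrow> 1) (at_right 0)" by simp
  then show ?thesis
  proof (rule Lim_transform_eventually)
    show "\<forall>\<^sub>F h in at_right 0. h powr (1 / a) * (Phi (1 / a) h - h powr - (1 / a)) + 1 = Kfun a h"
      unfolding eventually_at_right_field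
      by (intro exI[of _ 1]) (auto simp: Kfun_def right_diff_distrib powr_minus)
  qed
qed

lemma Xfun_filterlim:
  assumes a: "1 / 2 < a"
  shows "filterlim (Xfun a) (at_right 0) (at_right 0)"
proof -
  have "((\<lambda>h. h * Kfun a h powr (- a)) \<longlongrightarrow> 0 * 1 powr (- a)) (at_right 0)"
    using Kfun_tendsto_1[OF a] by (intro tendsto_intros) auto
  then have lim: "((\<lambda>h. h * Kfun a h powr (- a)) \<longlongrightarrow> 0) (at_right 0)" by simp
  have "(Xfun a \<longlongrightarrow> 0) (at_right 0)"
    by (rule Lim_transform_eventually[OF lim])
       (auto simp: eventually_at_right_field Xfun_eq[OF a] intro!: exI[of _ 1])
  moreover have "\<forall>\<^sub>F h in at_right 0. Xfun a h \<in> {0<..} \<and> Xfun a h \<noteq> 0"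
    unfolding eventually_at_right_field using Xfun_pos[OF a]
    by (intro exI[of _ 1]) (auto, metis less_irrefl)
  ultimately show ?thesis by (simp add: filterlim_at)
qed

text \<open>This replaces an initial value at the singular point 0: \<open>w\<close> may lack a
  limit there, but w k \<le> w h \<le> g h for small \<open>h\<close>, and \<open>g\<close> has
  one.\<close>

lemma le_limit_of_nonincreasing:
  fixes w g :: "real \<Rightarrow> real"
  assumes w: "\<And>h. 0 < h \<Longrightarrow> \<exists>y. DERIV w h :> y \<and> y \<le> 0"
    and g: "\<And>h. 0 < h \<Longrightarrow> w h \<le> g h" "(g \<longlongrightarrow> l) (at_right 0)" and k: "0 < k"
  shows "w k \<le> l"
proof (rule tendsto_lowerbound[OF g(2)])
  have "w k \<le> g h" if "0 < h" "h < k" for h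
    using DERIV_nonpos_imp_nonincreasing[of h k w] w g(1)[of h] that by force
  then show "\<forall>\<^sub>F h in at_right 0. w k \<le> g h"
    unfolding eventually_at_right_field using k by blast
qed simp

text \<open>The smallest exponent in the even part is 2, which exceeds 1/a.\<close>

lemma psum_even_part_powr_tendsto:
  assumes a: "1 / 2 < a"
  shows "((\<lambda>x. psum (even_part a) N x * x powr (- (1 / a))) \<longlongrightarrow> 0) (at_right 0)"
proof -
  have "((\<lambda>x. even_part a n * x ^ n * x powr (- (1 / a))) \<longlongrightarrow> 0) (at_right 0)" for n
  proof (cases "n \<ge> 2")
    case True
    then have n: "real n - 1 / a > 0" using inverse_range[OF a] by linarith
    have "((\<lambda>x. even_part a n * x powr (real n - 1 / a)) \<longlongrightarrow> even_part a n * 0) (at_right 0)"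
      by (intro tendsto_mult tendsto_const) (use n in real_asymp)
    then have lim: "((\<lambda>x. even_part a n * x powr (real n - 1 / a)) \<longlongrightarrow> 0) (at_right 0)" by simp
    show ?thesis
      by (rule Lim_transform_eventually[OF lim])
         (auto simp: eventually_at_right_field powr_diff powr_realpow powr_minus divide_inverse
            intro!: exI[of _ 1])
  qed (auto simp: even_part_def)
  then have "((\<lambda>x. \<Sum>n<N. even_part a n * x ^ n * x powr (- (1 / a))) \<longlongrightarrow> (\<Sum>n<N. 0)) (at_right 0)"
    by (intro tendsto_sum)
  then show ?thesis by (simp add: psum_def sum_distrib_right)
qed

text \<open>Only \<open>l \<le> 1\<close> is claimed because a truncation with
  \<open>N \<le> 1\<close> misses the linear term and has limit 0.\<close>

lemma psum_odd_part_div_tendsto: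
  obtains l where "l \<le> 1" "((\<lambda>x. psum (odd_part a) N x / x) \<longlongrightarrow> l) (at_right 0)"
proof
  let ?l = "\<lambda>n. if n = 1 then 1 else 0 :: real"
  show "(\<Sum>n<N. ?l n) \<le> 1" by (simp add: sum.delta)
  have "((\<lambda>x. odd_part a n * x ^ n / x) \<longlongrightarrow> ?l n) (at_right 0)" for n
  proof -
    consider "n = 0" | "n = 1" | k where "n = Suc (Suc k)" by (cases n; cases "n - 1") auto
    then show ?thesis
    proof cases
      case 2
      have "((\<lambda>x::real. 1::real) \<longlongrightarrow> 1) (at_right 0)" by simp
      then have "((\<lambda>x. x / x) \<longlongrightarrow> (1::real)) (at_right 0)"
        by (rule Lim_transform_eventually)
           (auto simp: eventually_at_right_field intro!: exI[of _ 1])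
      with 2 show ?thesis by simp
    next
      case 3
      have "((\<lambda>x. odd_part a n * x ^ Suc k) \<longlongrightarrow> odd_part a n * 0 ^ Suc k) (at_right 0)"
        by (intro tendsto_intros)
      with 3 have lim: "((\<lambda>x. odd_part a n * x ^ Suc k) \<longlongrightarrow> ?l n) (at_right 0)" by simp
      show ?thesis
        by (rule Lim_transform_eventually[OF lim])
           (auto simp: eventually_at_right_field 3 intro!: exI[of _ 1])
    qed simp
  qed
  then have "((\<lambda>x. \<Sum>n<N. odd_part a n * x ^ n / x) \<longlongrightarrow> (\<Sum>n<N. ?l n)) (at_right 0)"
    by (intro tendsto_sum)
  then show "((\<lambda>x. psum (odd_part a) N x / x) \<longlongrightarrow> (\<Sum>n<N. ?l n)) (at_right 0)"
    by (simp add: psum_def sum_divide_distrib)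
qed

text \<open>The even part of the candidate, without its constant 1, is nonnegative; this is
  \<open>Phi_ge\<close> multiplied by h^(1/a) sqrt(1 + h^2).\<close>

lemma Kfun_sqrt_ge_1:
  assumes a: "1 / 2 < a" and h: "h > 0"
  shows "Kfun a h * sqrt (1 + h\<^sup>2) \<ge> 1"
proof -
  have q: "sqrt (1 + h\<^sup>2) > 0" by (simp add: add_pos_nonneg)
  have "h powr (1 / a) * (h powr (- (1 / a)) / sqrt (1 + h\<^sup>2)) \<le> Kfun a h"
    unfolding Kfun_def by (intro mult_left_mono Phi_ge inverse_range[OF a]) auto
  then show ?thesis using q h by (simp add: powr_minus field_simps)
qed

text \<open>The factor \<open>k\<close> is left uncancelled to match the common denominator
  \<open>Kfun a h * h * sqrt (1 + h\<^sup>2)\<close>.\<close>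

lemma sqrt_has_derivative:
  assumes "h > 0" "k > 0"
  shows "((\<lambda>h::real. sqrt (1 + h\<^sup>2)) has_real_derivative k * h\<^sup>2 / (k * h * sqrt (1 + h\<^sup>2))) (at h)"
proof -
  have "1 + h\<^sup>2 > 0" by (simp add: add_pos_nonneg)
  moreover have "((\<lambda>h::real. sqrt (1 + h\<^sup>2)) has_real_derivative h / sqrt (1 + h\<^sup>2)) (at h)"
    using calculation by (auto intro!: derivative_eq_intros simp: field_simps)
  ultimately show ?thesis using assms by (simp add: power2_eq_square)
qed

text \<open>A comparison argument of Gronwall type from the origin. The induction is over arbitrary
  \<open>h\<close> because the inequality at \<open>k\<close> is integrated along all of (0, k], and
  the induction hypothesis is used at each point of it.\<close>

lemma psum_le_majorant:
  assumes a: "1 / 2 < a" and h: "h > 0"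
  shows "psum (even_part a) N (Xfun a h) \<le> Kfun a h * sqrt (1 + h\<^sup>2) - 1 \<and>
         psum (odd_part a) N (Xfun a h) \<le> Kfun a h * h"
  using h
proof (induction N arbitrary: h)
  case 0
  then show ?case using Kfun_sqrt_ge_1[OF a 0] Kfun_pos[OF a 0] by (simp add: psum_def)
next
  case (Suc N k)
  have a0: "a > 0" using a by simp
  let ?u = "\<lambda>h. Kfun a h * h * sqrt (1 + h\<^sup>2)"
  let ?A = "\<lambda>h. Kfun a h * sqrt (1 + h\<^sup>2) - 1"
  have u: "?u h > 0" if "h > 0" for h
    using that Kfun_pos[OF a that] by (simp add: add_pos_nonneg)
  \<comment> \<open>Multiplying by the integrating factors \<open>x powr (- 1 / a) = Phi (1 / a) h\<close> and, for the odd part below, \<open>1 / x\<close>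
    removes the linear terms, so that the differences decrease in \<open>h\<close>.\<close>
  let ?w = "\<lambda>h. (psum (even_part a) (Suc N) (Xfun a h) - ?A h) * Phi (1 / a) h"
  have "?w k \<le> 0"
  proof (rule le_limit_of_nonincreasing[OF _ _ _ \<open>k > 0\<close>])
    fix h :: real assume h: "h > 0"
    let ?X = "Xfun a h" and ?K = "Kfun a h" and ?q = "sqrt (1 + h\<^sup>2)" and ?\<phi> = "Phi (1 / a) h"
    let ?S = "psum (even_part a) (Suc N) ?X" and ?P = "psum (\<lambda>n. real n * even_part a n) (Suc N) ?X"
    note pos = Kfun_pos[OF a h] Xfun_pos[OF a h] Phi_pos[OF inverse_range[OF a] h] u[OF h]
    have D: "(?w has_real_derivative
        (?P / ?X * (?X / ?u h) - (1 / a * ?K * ?A h / ?u h * ?q + ?K * h\<^sup>2 / ?u h * ?K)) * ?\<phi>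
          + - (1 / a * ?\<phi> / ?u h) * (?S - ?A h)) (at h)"
      by (intro DERIV_mult DERIV_diff[where E = "_ + _"] DERIV_diff[where E = 0, simplified]
        DERIV_chain2[OF psum_has_derivative Xfun_has_derivative[OF a h]] Kfun_has_derivative[OF a h]
        Phi_has_derivative'[OF a h] sqrt_has_derivative[OF h pos(1)]) (use pos in auto)
    \<comment> \<open>Here the exact equation for the candidate enters: the linear terms cancel
      against the integrating factor, and the sign is that of the defect in the truncated even
      equation.\<close>
    have E: "(P / X * (X / v) - (1 / a * K * (K * q - 1) / v * q + K * r / v * K)) * \<phi>
          + - (1 / a * \<phi> / v) * (S - (K * q - 1)) =
          \<phi> / v / a * ((a * P - S) - ((K * q - 1)\<^sup>2 + a * (K\<^sup>2 * r)))"
      if "X > 0" "v > 0" for P X v K q \<phi> S r :: real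
      using that a0 by (simp add: field_simps power2_eq_square)
    have "a * ?P - ?S \<le> (?A h)\<^sup>2 + a * (?K\<^sup>2 * h\<^sup>2)"
    proof -
      have "a * ?P - ?S \<le> (psum (even_part a) N ?X)\<^sup>2 + a * (psum (odd_part a) N ?X)\<^sup>2"
        by (intro psum_even_part_le a less_imp_le pos)
      also have "\<dots> \<le> (?A h)\<^sup>2 + a * (?K * h)\<^sup>2"
        using Suc.IH[OF h] a0 pos(2)
        by (intro add_mono mult_left_mono power_mono psum_nonneg even_part_nonneg odd_part_nonneg a) auto
      finally show ?thesis by (simp add: power_mult_distrib)
    qed
    then have "?\<phi> / ?u h / a * ((a * ?P - ?S) - ((?A h)\<^sup>2 + a * (?K\<^sup>2 * h\<^sup>2))) \<le> 0"
      using pos a0 by (intro mult_nonneg_nonpos) auto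
    with D[unfolded E[OF pos(2,4), of ?P ?K ?q "h\<^sup>2" ?\<phi> ?S]]
    show "\<exists>y. DERIV ?w h :> y \<and> y \<le> 0" by blast
    \<comment> \<open>Dropping the nonnegative candidate term leaves x^(-1/a) times the truncation,
      whose limit at 0 is known.\<close>
    have "?w h \<le> ?S * ?\<phi>"
      using Kfun_sqrt_ge_1[OF a h] pos(3) by (intro mult_right_mono) auto
    then show "?w h \<le> ?S * ?X powr (- (1 / a))" by (simp only: Xfun_powr[OF a h])
  next
    show "((\<lambda>h. psum (even_part a) (Suc N) (Xfun a h) * Xfun a h powr (- (1 / a))) \<longlongrightarrow> 0) (at_right 0)"
      by (rule filterlim_compose[OF psum_even_part_powr_tendsto[OF a] Xfun_filterlim[OF a]])
  qed
  then have 1: "psum (even_part a) (Suc N) (Xfun a k) \<le> ?A k"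
    using Phi_pos[OF inverse_range[OF a] \<open>k > 0\<close>] by (simp add: mult_le_0_iff)
  let ?v = "\<lambda>h. (psum (odd_part a) (Suc N) (Xfun a h) - Kfun a h * h) / Xfun a h"
  obtain l where l: "l \<le> 1" "((\<lambda>x. psum (odd_part a) (Suc N) x / x) \<longlongrightarrow> l) (at_right 0)"
    using psum_odd_part_div_tendsto .
  \<comment> \<open>The subtracted term is the limit of \<open>Kfun a h * h / Xfun a h\<close>,
    which equals K * K^a for K = \<open>Kfun a h\<close>; the bound is at most 0 as
    \<open>l \<le> 1\<close>.\<close>
  have "?v k \<le> l - 1 * 1 powr a"
  proof (rule le_limit_of_nonincreasing[OF _ _ _ \<open>k > 0\<close>])
    fix h :: real assume h: "h > 0"
    let ?X = "Xfun a h" and ?K = "Kfun a h" and ?q = "sqrt (1 + h\<^sup>2)"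
    let ?S = "psum (odd_part a) (Suc N) ?X" and ?P = "psum (\<lambda>n. real n * odd_part a n) (Suc N) ?X"
    note pos = Kfun_pos[OF a h] Xfun_pos[OF a h] u[OF h]
    have D: "(?v has_real_derivative
        ((?P / ?X * (?X / ?u h) - (1 / a * ?K * ?A h / ?u h * h + 1 * ?K)) * ?X
          - (?S - ?K * h) * (?X / ?u h)) / (?X * ?X)) (at h)"
      by (intro DERIV_divide DERIV_mult DERIV_diff DERIV_ident Xfun_has_derivative[OF a h]
        DERIV_chain2[OF psum_has_derivative Xfun_has_derivative[OF a h]] Kfun_has_derivative[OF a h])
        (use pos in auto)
    have E: "((P / X * (X / (K * h * q)) - (1 / a * K * (K * q - 1) / (K * h * q) * h + 1 * K)) * X
          - (S - K * h) * (X / (K * h * q))) / (X * X) =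
        1 / (K * h * q * X * a) * (a * (P - S) - (1 + a) * ((K * q - 1) * (K * h)))"
      if "X > 0" "K > 0" "q > 0" for P X K q S :: real
      using that a0 h by (simp add: field_simps)
    have q: "?q > 0" by (simp add: add_pos_nonneg)
    have "a * (?P - ?S) \<le> (1 + a) * (?A h * (?K * h))"
    proof -
      have "a * (?P - ?S) \<le> (1 + a) * (psum (even_part a) N ?X * psum (odd_part a) N ?X)"
        by (intro psum_odd_part_le a less_imp_le pos)
      also have "\<dots> \<le> (1 + a) * (?A h * (?K * h))"
        using Suc.IH[OF h] a0 pos(2) Kfun_sqrt_ge_1[OF a h]
        by (intro mult_left_mono mult_mono psum_nonneg even_part_nonneg odd_part_nonneg a) auto
      finally show ?thesis .
    qed
    then have "1 / (?u h * ?X * a) * (a * (?P - ?S) - (1 + a) * (?A h * (?K * h))) \<le> 0"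
      using pos a0 by (intro mult_nonneg_nonpos) auto
    with D[unfolded E[OF pos(2,1) q, of ?P ?S]]
    show "\<exists>y. DERIV ?v h :> y \<and> y \<le> 0" by blast
    have "?K * h / ?X = ?K * ?K powr a"
      using pos h by (simp add: Xfun_eq[OF a h] powr_minus_divide)
    then show "?v h \<le> ?S / ?X - ?K * ?K powr a" by (simp add: diff_divide_distrib)
  next
    show "((\<lambda>h. psum (odd_part a) (Suc N) (Xfun a h) / Xfun a h - Kfun a h * Kfun a h powr a)
      \<longlongrightarrow> l - 1 * 1 powr a) (at_right 0)"
      by (intro tendsto_intros filterlim_compose[OF l(2) Xfun_filterlim[OF a]] Kfun_tendsto_1[OF a]) auto
  qed
  then have "?v k \<le> 0" using l(1) by simp
  then have 2: "psum (odd_part a) (Suc N) (Xfun a k) \<le> Kfun a k * k"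
    using Xfun_pos[OF a \<open>k > 0\<close>] by (simp add: divide_le_0_iff)
  from 1 2 show ?case ..
qed

text \<open>The condition x < 1/rho says that x^(-1/a) exceeds \<open>rho a powr (1 / a)\<close>,
  the limit of \<open>Phi\<close> at infinity.\<close>

lemma Xfun_surj:
  assumes a: "1 / 2 < a" and x: "0 < x" "x < 1 / rho a"
  obtains h where "h > 0" "Phi (1 / a) h = x powr (- (1 / a))" "Xfun a h = x"
proof -
  have "1 / x > rho a" using x rho_pos[OF a] by (simp add: field_simps)
  then have "(1 / x) powr (1 / a) > rho a powr (1 / a)"
    using rho_pos[OF a] inverse_range[OF a] by (intro powr_less_mono2) auto
  then have "x powr (- (1 / a)) > rho a powr (1 / a)"
    using x by (simp add: powr_divide powr_minus_divide)
  then obtain h where h: "h > 0" "Phi (1 / a) h = x powr (- (1 / a))"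
    using Phi_surj[OF a] by metis
  moreover have "Xfun a h = x"
    unfolding Xfun_def h(2) powr_powr using a x by simp
  ultimately show ?thesis using that by blast
qed

lemma summable_parts:
  assumes a: "1 / 2 < a" and x: "0 < x" "x < 1 / rho a"
  shows "summable (\<lambda>n. even_part a n * x ^ n)" "summable (\<lambda>n. odd_part a n * x ^ n)"
proof -
  obtain h where h: "h > 0" "Xfun a h = x" using Xfun_surj[OF a x] by metis
  show "summable (\<lambda>n. even_part a n * x ^ n)"
    using psum_le_majorant[OF a h(1)] x even_part_nonneg[OF a]
    by (intro summableI_nonneg_bounded[of _ "Kfun a h * sqrt (1 + h\<^sup>2) - 1"]) (auto simp: psum_def h(2))
  show "summable (\<lambda>n. odd_part a n * x ^ n)"
    using psum_le_majorant[OF a h(1)] x odd_part_nonneg[OF a]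
    by (intro summableI_nonneg_bounded[of _ "Kfun a h * h"]) (auto simp: psum_def h(2))
qed

section \<open>The differential equations\<close>

lemma powser_Euler_derivative:
  fixes p :: "nat \<Rightarrow> real"
  assumes sm: "\<And>y. 0 < y \<Longrightarrow> y < R \<Longrightarrow> summable (\<lambda>n. p n * y ^ n)" and x: "0 < x" "x < R"
  shows "summable (\<lambda>n. real n * p n * x ^ n)"
    and "((\<lambda>x. \<Sum>n. p n * x ^ n) has_real_derivative (\<Sum>n. real n * p n * x ^ n) / x) (at x)"
proof -
  obtain y where y: "x < y" "y < R" using dense[OF x(2)] by blast
  have sy: "summable (\<lambda>n. p n * y ^ n)" using sm y x by simp
  have "summable (\<lambda>n. diffs p n * x ^ n)"
    by (rule termdiff_converges[of _ y]) (use x y in \<open>auto intro: powser_inside[OF sy]\<close>)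
  from sums_mult[OF diffs_equiv[OF this], of x]
  have "(\<lambda>n. x * (real n * p n * x ^ (n - Suc 0))) sums (x * (\<Sum>n. diffs p n * x ^ n))" .
  moreover have "x * (real n * p n * x ^ (n - Suc 0)) = real n * p n * x ^ n" for n
    by (cases n) auto
  ultimately have *: "(\<lambda>n. real n * p n * x ^ n) sums (x * (\<Sum>n. diffs p n * x ^ n))" by simp
  then show "summable (\<lambda>n. real n * p n * x ^ n)" by (rule sums_summable)
  have "(\<Sum>n. diffs p n * x ^ n) = (\<Sum>n. real n * p n * x ^ n) / x"
    using sums_unique[OF *] x by (simp add: field_simps)
  with termdiffs_strong[OF sy, of x] x y
  show "((\<lambda>x. \<Sum>n. p n * x ^ n) has_real_derivative (\<Sum>n. real n * p n * x ^ n) / x) (at x)" by simp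
qed

lemma powser_Cauchy_product:
  fixes p q :: "nat \<Rightarrow> real"
  assumes "\<And>n. p n \<ge> 0" "\<And>n. q n \<ge> 0" "x \<ge> 0"
    and "summable (\<lambda>n. p n * x ^ n)" "summable (\<lambda>n. q n * x ^ n)"
  shows "(\<lambda>n. (\<Sum>i\<le>n. p i * q (n - i)) * x ^ n) sums ((\<Sum>n. p n * x ^ n) * (\<Sum>n. q n * x ^ n))"
proof -
  have "(\<Sum>i\<le>n. p i * x ^ i * (q (n - i) * x ^ (n - i))) = (\<Sum>i\<le>n. p i * q (n - i)) * x ^ n" for n
    unfolding sum_distrib_right
  proof (intro sum.cong refl)
    fix i assume "i \<in> {..n}"
    then have "x ^ n = x ^ i * x ^ (n - i)" by (simp flip: power_add)
    then show "p i * x ^ i * (q (n - i) * x ^ (n - i)) = p i * q (n - i) * x ^ n" by simp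
  qed
  moreover have "(\<lambda>n. \<Sum>i\<le>n. p i * x ^ i * (q (n - i) * x ^ (n - i))) sums
      ((\<Sum>n. p n * x ^ n) * (\<Sum>n. q n * x ^ n))"
    by (rule Cauchy_product_sums) (use assms in auto)
  ultimately show ?thesis by simp
qed

text \<open>For n \<ge> k one has (x/r)^n \<le> (x/r)^k. With a fixed \<open>r\<close> this yields
  explicit rates at 0: order 2 for e and order 3 for o - x.\<close>

lemma powser_vanishing_order_le:
  fixes p :: "nat \<Rightarrow> real"
  assumes p: "\<And>n. p n \<ge> 0" "\<And>n. n < k \<Longrightarrow> p n = 0" and x: "0 \<le> x" "x \<le> r" "0 < r"
    and sm: "summable (\<lambda>n. p n * x ^ n)" "summable (\<lambda>n. p n * r ^ n)"
  shows "(\<Sum>n. p n * x ^ n) \<le> (x / r) ^ k * (\<Sum>n. p n * r ^ n)"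
proof -
  have "p n * x ^ n \<le> (x / r) ^ k * (p n * r ^ n)" for n
  proof (cases "n < k")
    case False
    have "x ^ n = (x / r) ^ n * r ^ n" using x by (simp add: power_divide)
    also have "\<dots> \<le> (x / r) ^ k * r ^ n"
      using x False by (intro mult_right_mono power_decreasing) auto
    finally have "p n * x ^ n \<le> p n * ((x / r) ^ k * r ^ n)" by (rule mult_left_mono[OF _ p(1)])
    then show ?thesis by (simp add: mult_ac)
  qed (simp add: p(2))
  then show ?thesis
    unfolding suminf_mult[OF sm(2), symmetric] by (intro suminf_le sm summable_mult)
qed

text \<open>The equations hold only for x > 0, so a constant of integration is read off as a limit
  from the right.\<close>

lemma has_zero_derivative_eq_limit:
  fixes f :: "real \<Rightarrow> real"
  assumes f: "\<And>x. 0 < x \<Longrightarrow> x < R \<Longrightarrow> DERIV f x :> 0" and l: "(f \<longlongrightarrow> l) (at_right 0)"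
    and x: "0 < x" "x < R"
  shows "f x = l"
proof (rule tendsto_unique[OF _ _ l])
  show "(f \<longlongrightarrow> f x) (at_right 0)"
  proof (rule Lim_transform_eventually[OF tendsto_const])
    have "f x = f y" if "0 < y" "y < R" for y
      using DERIV_isconst3[of 0 R x y f] f x that by auto
    then show "\<forall>\<^sub>F y in at_right 0. f x = f y"
      unfolding eventually_at_right_field using x by (intro exI[of _ R]) auto
  qed
qed simp

definition Eser :: "real \<Rightarrow> real \<Rightarrow> real" where
  "Eser a x = (\<Sum>n. even_part a n * x ^ n)"

definition Oser :: "real \<Rightarrow> real \<Rightarrow> real" where
  "Oser a x = (\<Sum>n. odd_part a n * x ^ n)"

lemma M_eq_Eser_Oser:
  assumes a: "1 / 2 < a" and x: "0 < x" "x < 1 / rho a"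
  shows "summable (\<lambda>n. m a n * x ^ n)" "M a x = 1 + Eser a x + Oser a x"
proof -
  have "(\<lambda>n. (if n = 0 then 1 else 0) + even_part a n * x ^ n + odd_part a n * x ^ n) sums
      (1 + Eser a x + Oser a x)"
    unfolding Eser_def Oser_def
    by (intro sums_add summable_sums summable_parts[OF a x]) (rule sums_single)
  moreover have "(if n = 0 then 1 else 0) + even_part a n * x ^ n + odd_part a n * x ^ n = m a n * x ^ n" for n
    unfolding m_split[of a n] by (simp add: algebra_simps)
  ultimately have "(\<lambda>n. m a n * x ^ n) sums (1 + Eser a x + Oser a x)" by simp
  then show "summable (\<lambda>n. m a n * x ^ n)" "M a x = 1 + Eser a x + Oser a x"
    unfolding M_def by (auto simp: sums_iff)
qed

lemma Eser_has_derivative: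
  assumes a: "1 / 2 < a" and x: "0 < x" "x < 1 / rho a"
  shows "(Eser a has_real_derivative
     (Eser a x + (Eser a x)\<^sup>2 + a * (Oser a x)\<^sup>2) / (a * x)) (at x)"
proof -
  note d = powser_Euler_derivative[OF summable_parts(1)[OF a] x]
  note sm = summable_parts[OF a x]
  let ?P = "\<Sum>n. real n * even_part a n * x ^ n"
  have "(\<lambda>n. (\<Sum>i\<le>n. even_part a i * even_part a (n - i)) * x ^ n +
      a * ((\<Sum>i\<le>n. odd_part a i * odd_part a (n - i)) * x ^ n)) sums
      (Eser a x * Eser a x + a * (Oser a x * Oser a x))"
    unfolding Eser_def Oser_def
    by (intro sums_add sums_mult powser_Cauchy_product even_part_nonneg odd_part_nonneg a sm) (use x in auto)
  moreover have "(\<Sum>i\<le>n. even_part a i * even_part a (n - i)) * x ^ n +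
      a * ((\<Sum>i\<le>n. odd_part a i * odd_part a (n - i)) * x ^ n) =
      a * (real n * even_part a n * x ^ n) - even_part a n * x ^ n" for n
    unfolding mult.assoc[symmetric] distrib_right[symmetric] even_part_rec[OF a, symmetric]
    by (simp add: algebra_simps)
  ultimately have "(\<lambda>n. a * (real n * even_part a n * x ^ n) - even_part a n * x ^ n) sums
      (Eser a x * Eser a x + a * (Oser a x * Oser a x))" by simp
  moreover have "(\<lambda>n. a * (real n * even_part a n * x ^ n) - even_part a n * x ^ n) sums
      (a * ?P - Eser a x)"
    unfolding Eser_def by (intro sums_diff sums_mult summable_sums d(1) sm)
  ultimately have "Eser a x * Eser a x + a * (Oser a x * Oser a x) = a * ?P - Eser a x"
    by (rule sums_unique2)
  then have "?P / x = (Eser a x + (Eser a x)\<^sup>2 + a * (Oser a x)\<^sup>2) / (a * x)"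
    using a x by (simp add: field_simps power2_eq_square)
  with d(2) show ?thesis by (simp add: Eser_def[abs_def])
qed

lemma Oser_has_derivative:
  assumes a: "1 / 2 < a" and x: "0 < x" "x < 1 / rho a"
  shows "(Oser a has_real_derivative
     (a * Oser a x + (1 + a) * (Eser a x * Oser a x)) / (a * x)) (at x)"
proof -
  note d = powser_Euler_derivative[OF summable_parts(2)[OF a] x]
  note sm = summable_parts[OF a x]
  let ?P = "\<Sum>n. real n * odd_part a n * x ^ n"
  have "(\<lambda>n. (1 + a) * ((\<Sum>i\<le>n. even_part a i * odd_part a (n - i)) * x ^ n)) sums
      ((1 + a) * (Eser a x * Oser a x))"
    unfolding Eser_def Oser_def
    by (intro sums_mult powser_Cauchy_product even_part_nonneg odd_part_nonneg a sm) (use x in auto)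
  moreover have "(1 + a) * ((\<Sum>i\<le>n. even_part a i * odd_part a (n - i)) * x ^ n) =
      a * (real n * odd_part a n * x ^ n - odd_part a n * x ^ n)" for n
    unfolding mult.assoc[symmetric] odd_part_rec[OF a, symmetric]
    by (simp add: algebra_simps)
  ultimately have "(\<lambda>n. a * (real n * odd_part a n * x ^ n - odd_part a n * x ^ n)) sums
      ((1 + a) * (Eser a x * Oser a x))" by simp
  moreover have "(\<lambda>n. a * (real n * odd_part a n * x ^ n - odd_part a n * x ^ n)) sums
      (a * (?P - Oser a x))"
    unfolding Oser_def by (intro sums_diff sums_mult summable_sums d(1) sm)
  ultimately have "(1 + a) * (Eser a x * Oser a x) = a * (?P - Oser a x)"
    by (rule sums_unique2)
  then have "?P / x = (a * Oser a x + (1 + a) * (Eser a x * Oser a x)) / (a * x)"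
    using a x by (simp add: field_simps)
  with d(2) show ?thesis by (simp add: Oser_def[abs_def])
qed

lemma Eser_nonneg:
  assumes a: "1 / 2 < a" and x: "0 < x" "x < 1 / rho a"
  shows "Eser a x \<ge> 0"
  unfolding Eser_def by (intro suminf_nonneg summable_parts[OF a x]) (use x even_part_nonneg[OF a] in auto)

lemma Eser_le:
  assumes a: "1 / 2 < a" and x: "0 < x" "x \<le> r" "r < 1 / rho a"
  shows "Eser a x \<le> (x / r)\<^sup>2 * Eser a r"
  unfolding Eser_def using x
  by (intro powser_vanishing_order_le summable_parts[OF a] even_part_nonneg a) (auto simp: even_part_def)

lemma Oser_bounds:
  assumes a: "1 / 2 < a" and x: "0 < x" "x \<le> r" "r < 1 / rho a"
  shows "x \<le> Oser a x" "Oser a x \<le> x + (x / r) ^ 3 * (Oser a r - r)"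
proof -
  let ?p = "\<lambda>n. if n = 1 then 0 else odd_part a n"
  have s: "(\<lambda>n. ?p n * y ^ n) sums (Oser a y - y)" if y: "0 < y" "y < 1 / rho a" for y
  proof -
    have "(\<lambda>n. odd_part a n * y ^ n - (if n = 1 then y else 0)) sums (Oser a y - y)"
      unfolding Oser_def
      by (intro sums_diff summable_sums summable_parts[OF a y]) (rule sums_single)
    moreover have "odd_part a n * y ^ n - (if n = 1 then y else 0) = ?p n * y ^ n" for n by auto
    ultimately show ?thesis by simp
  qed
  have px: "0 < x" "x < 1 / rho a" and pr: "0 < r" "r < 1 / rho a" using x by auto
  note sx = s[OF px] and sr = s[OF pr]
  have p: "?p n \<ge> 0" for n using odd_part_nonneg[OF a] by simp
  have p3: "?p n = 0" if "n < 3" for n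
    using that by (auto simp: odd_part_def numeral_3_eq_3 less_Suc_eq)
  have "0 \<le> Oser a x - x"
    unfolding sums_unique[OF sx] by (intro suminf_nonneg sums_summable[OF sx] mult_nonneg_nonneg p) (use x in auto)
  then show "x \<le> Oser a x" by simp
  have "Oser a x - x \<le> (x / r) ^ 3 * (Oser a r - r)"
    unfolding sums_unique[OF sx] sums_unique[OF sr]
    by (rule powser_vanishing_order_le[OF p p3 _ _ _ sums_summable[OF sx] sums_summable[OF sr]])
       (use x in auto)
  then show "Oser a x \<le> x + (x / r) ^ 3 * (Oser a r - r)" by simp
qed

section \<open>Integration of the system\<close>

definition Lfun :: "real \<Rightarrow> real \<Rightarrow> real" where
  "Lfun a x = Oser a x / x"

definition Hfun :: "real \<Rightarrow> real \<Rightarrow> real" where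
  "Hfun a x = Oser a x * Lfun a x powr (- (1 / (1 + a)))"

lemma Lfun_ge_1:
  assumes a: "1 / 2 < a" and x: "0 < x" "x < 1 / rho a"
  shows "Lfun a x \<ge> 1"
  using Oser_bounds(1)[OF a x(1) order_refl x(2)] x(1) by (simp add: Lfun_def)

lemma Lfun_le:
  assumes a: "1 / 2 < a" and x: "0 < x" "x \<le> r" "r < 1 / rho a"
  shows "Lfun a x \<le> 1 + x\<^sup>2 * ((Oser a r - r) / r ^ 3)"
proof -
  have "Oser a x / x \<le> (x + (x / r) ^ 3 * (Oser a r - r)) / x"
    using Oser_bounds(2)[OF a x] x by (intro divide_right_mono) auto
  also have "\<dots> = 1 + x\<^sup>2 * ((Oser a r - r) / r ^ 3)"
    using x by (simp add: field_simps power2_eq_square power3_eq_cube)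
  finally show ?thesis by (simp add: Lfun_def)
qed

lemma Lfun_has_derivative:
  assumes a: "1 / 2 < a" and x: "0 < x" "x < 1 / rho a"
  shows "(Lfun a has_real_derivative (1 + a) * Eser a x * Lfun a x / (a * x)) (at x)"
proof -
  have "((\<lambda>x. Oser a x / x) has_real_derivative
     ((a * Oser a x + (1 + a) * (Eser a x * Oser a x)) / (a * x) * x - Oser a x * 1) / (x * x)) (at x)"
    by (intro DERIV_divide Oser_has_derivative a x DERIV_ident) (use x in auto)
  moreover have "((a * Oser a x + (1 + a) * (Eser a x * Oser a x)) / (a * x) * x - Oser a x * 1) / (x * x)
     = (1 + a) * Eser a x * Lfun a x / (a * x)"
    using a x by (simp add: Lfun_def field_simps)
  ultimately show ?thesis by (simp add: Lfun_def[abs_def])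
qed

lemma R_pos: "1 / 2 < a \<Longrightarrow> \<exists>r. 0 < r \<and> r < 1 / rho a"
  using dense[of 0 "1 / rho a"] rho_pos[of a] by simp

lemma Lfun_tendsto: assumes a: "1 / 2 < a" shows "(Lfun a \<longlongrightarrow> 1) (at_right 0)"
proof -
  obtain r where r: "0 < r" "r < 1 / rho a" using R_pos[OF a] by blast
  show ?thesis
  proof (rule tendsto_sandwich)
    show "\<forall>\<^sub>F x in at_right 0. 1 \<le> Lfun a x"
      unfolding eventually_at_right_field using Lfun_ge_1[OF a] r by (intro exI[of _ r]) auto
    show "\<forall>\<^sub>F x in at_right 0. Lfun a x \<le> 1 + x\<^sup>2 * ((Oser a r - r) / r ^ 3)"
      unfolding eventually_at_right_field using Lfun_le[OF a _ _ r(2)] r by (intro exI[of _ r]) auto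
    have "((\<lambda>x. 1 + x\<^sup>2 * ((Oser a r - r) / r ^ 3)) \<longlongrightarrow> 1 + 0\<^sup>2 * ((Oser a r - r) / r ^ 3)) (at_right 0)"
      by (intro tendsto_intros)
    then show "((\<lambda>x. 1 + x\<^sup>2 * ((Oser a r - r) / r ^ 3)) \<longlongrightarrow> 1) (at_right 0)" by simp
  qed simp
qed

lemma Oser_tendsto: assumes a: "1 / 2 < a" shows "(Oser a \<longlongrightarrow> 0) (at_right 0)"
proof -
  have "((\<lambda>x. x * Lfun a x) \<longlongrightarrow> 0 * 1) (at_right 0)"
    by (intro tendsto_intros Lfun_tendsto a)
  then have lim: "((\<lambda>x. x * Lfun a x) \<longlongrightarrow> 0) (at_right 0)" by simp
  show ?thesis
    by (rule Lim_transform_eventually[OF lim])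
      (auto simp: eventually_at_right_field Lfun_def intro!: exI[of _ 1])
qed

lemma Eser_tendsto: assumes a: "1 / 2 < a" shows "(Eser a \<longlongrightarrow> 0) (at_right 0)"
proof -
  obtain r where r: "0 < r" "r < 1 / rho a" using R_pos[OF a] by blast
  show ?thesis
  proof (rule tendsto_sandwich)
    show "\<forall>\<^sub>F x in at_right 0. 0 \<le> Eser a x"
      unfolding eventually_at_right_field using Eser_nonneg[OF a] r by (intro exI[of _ r]) auto
    show "\<forall>\<^sub>F x in at_right 0. Eser a x \<le> (x / r)\<^sup>2 * Eser a r"
      unfolding eventually_at_right_field using Eser_le[OF a _ _ r(2)] r by (intro exI[of _ r]) auto
    have "((\<lambda>x. (x / r)\<^sup>2 * Eser a r) \<longlongrightarrow> (0 / r)\<^sup>2 * Eser a r) (at_right 0)"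
      using r by (intro tendsto_intros) auto
    then show "((\<lambda>x. (x / r)\<^sup>2 * Eser a r) \<longlongrightarrow> 0) (at_right 0)" by simp
  qed simp
qed

text \<open>The exponent is scaled by 1 + a so that the logarithmic derivative is -k e / (a x). The
  case k = 2 serves the conserved quantity, k = 1 the derivative of \<open>Hfun\<close>.\<close>

lemma Lfun_powr_has_derivative:
  assumes a: "1 / 2 < a" and x: "0 < x" "x < 1 / rho a"
  shows "((\<lambda>x. Lfun a x powr (- (k / (1 + a)))) has_real_derivative
    - k * (Lfun a x powr (- (k / (1 + a))) * Eser a x / (a * x))) (at x)"
proof -
  let ?t = "- (k / (1 + a))" and ?L = "Lfun a x"
  have L: "?L > 0" using Lfun_ge_1[OF a x] by simp
  have "?t * ?L powr (?t - 1) * ((1 + a) * Eser a x * ?L / (a * x)) =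
      (?t * (1 + a)) * (?L powr (?t - 1) * ?L) * Eser a x / (a * x)" by simp
  also have "?t * (1 + a) = - k" using a by simp
  also have "?L powr (?t - 1) * ?L = ?L powr ?t" using L by (simp add: powr_diff)
  finally have "?t * ?L powr (?t - 1) * ((1 + a) * Eser a x * ?L / (a * x)) =
      - k * (?L powr ?t * Eser a x / (a * x))" by (simp only: mult.assoc times_divide_eq_right)
  with DERIV_chain2[OF has_real_derivative_powr[OF L, of ?t] Lfun_has_derivative[OF a x]]
  show ?thesis by (simp only:)
qed

lemma conserved_quantity:
  assumes a: "1 / 2 < a" and x: "0 < x" "x < 1 / rho a"
  shows "((1 + Eser a x)\<^sup>2 - (Oser a x)\<^sup>2) * Lfun a x powr (- (2 / (1 + a))) = 1"
proof (rule has_zero_derivative_eq_limit[OF _ _ x])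
  let ?t = "- (2 / (1 + a))"
  fix x assume x: "0 < x" "x < 1 / rho a"
  let ?e = "Eser a x" and ?o = "Oser a x" and ?L = "Lfun a x"
  let ?e' = "(?e + ?e\<^sup>2 + a * ?o\<^sup>2) / (a * x)" and ?o' = "(a * ?o + (1 + a) * (?e * ?o)) / (a * x)"
  have dD: "((\<lambda>x. (1 + Eser a x)\<^sup>2 - (Oser a x)\<^sup>2) has_real_derivative 2 * (1 + ?e) * ?e' - 2 * ?o * ?o') (at x)"
    by (auto intro!: derivative_eq_intros Eser_has_derivative Oser_has_derivative a x simp: algebra_simps)
  have "2 * (1 + ?e) * ?e' - 2 * ?o * ?o' = 2 * ?e * ((1 + ?e)\<^sup>2 - ?o\<^sup>2) / (a * x)"
    using a x by (simp add: field_simps power2_eq_square)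
  note dD = dD[unfolded this]
  show "((\<lambda>x. ((1 + Eser a x)\<^sup>2 - (Oser a x)\<^sup>2) * Lfun a x powr ?t) has_real_derivative 0) (at x)"
    using DERIV_mult[OF dD Lfun_powr_has_derivative[OF a x, of 2]] by (simp add: mult_ac)
next
  have "((\<lambda>x. ((1 + Eser a x)\<^sup>2 - (Oser a x)\<^sup>2) * Lfun a x powr (- (2 / (1 + a)))) \<longlongrightarrow>
      ((1 + 0)\<^sup>2 - 0\<^sup>2) * 1 powr (- (2 / (1 + a)))) (at_right 0)"
    by (intro tendsto_intros Eser_tendsto Oser_tendsto Lfun_tendsto a) auto
  then show "((\<lambda>x. ((1 + Eser a x)\<^sup>2 - (Oser a x)\<^sup>2) * Lfun a x powr (- (2 / (1 + a)))) \<longlongrightarrow> 1) (at_right 0)"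
    by simp
qed

text \<open>Since o = x L and L = K^(1+a), dividing by K gives H = x K^a; the conserved quantity
  becomes (1 + e)^2 = K^2 (1 + H^2), with the positive root because e \<ge> 0. The bound K \<le> L
  carries the rate for L over to K.\<close>

lemma Hfun_relations:
  assumes a: "1 / 2 < a" and x: "0 < x" "x < 1 / rho a"
  defines "K \<equiv> Lfun a x powr (1 / (1 + a))"
  shows "K \<ge> 1" "K \<le> Lfun a x" "Hfun a x = x * K powr a" "Hfun a x > 0" "Oser a x = K * Hfun a x"
    "1 + Eser a x = K * sqrt (1 + (Hfun a x)\<^sup>2)"
proof -
  have L: "Lfun a x \<ge> 1" using Lfun_ge_1[OF a x] .
  have O: "Oser a x = x * Lfun a x" using x by (simp add: Lfun_def)
  show K1: "K \<ge> 1" unfolding K_def using L a by (intro ge_one_powr_ge_zero) auto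
  have "K \<le> Lfun a x powr 1" unfolding K_def using L a by (intro powr_mono) auto
  then show "K \<le> Lfun a x" using L by simp
  have H: "Hfun a x = Oser a x / K"
    unfolding Hfun_def K_def by (simp add: powr_minus_divide)
  then show OK: "Oser a x = K * Hfun a x" using K1 by simp
  have "K powr (1 + a) = Lfun a x"
    unfolding K_def powr_powr using L a by simp
  moreover have "K powr (1 + a) = K * K powr a" using K1 by (simp add: powr_add)
  ultimately show H2: "Hfun a x = x * K powr a" unfolding H O using K1 by (simp add: field_simps)
  show "Hfun a x > 0" unfolding H2 using x K1 by simp
  have "Lfun a x powr (- (2 / (1 + a))) = (K powr 2) powr - 1"
    unfolding K_def powr_powr by simp
  also have "\<dots> = 1 / K\<^sup>2" using K1 by (simp add: powr_minus_divide)
  finally have L2: "Lfun a x powr (- (2 / (1 + a))) = 1 / K\<^sup>2" .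
  have "((1 + Eser a x)\<^sup>2 - (Oser a x)\<^sup>2) * (1 / K\<^sup>2) = 1"
    using conserved_quantity[OF a x] unfolding L2 .
  then have "(1 + Eser a x)\<^sup>2 - (Oser a x)\<^sup>2 = K\<^sup>2" using K1 by (simp add: divide_eq_1_iff)
  then have "(1 + Eser a x)\<^sup>2 = K\<^sup>2 + (K * Hfun a x)\<^sup>2" unfolding OK by simp
  also have "\<dots> = K\<^sup>2 * (1 + (Hfun a x)\<^sup>2)" by (simp add: algebra_simps power_mult_distrib)
  also have "\<dots> = (K * sqrt (1 + (Hfun a x)\<^sup>2))\<^sup>2" by (simp add: power_mult_distrib)
  finally show "1 + Eser a x = K * sqrt (1 + (Hfun a x)\<^sup>2)"
    using Eser_nonneg[OF a x] K1 by (subst (asm) power2_eq_iff_nonneg) auto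
qed

lemma Hfun_powr:
  assumes a: "1 / 2 < a" and x: "0 < x" "x < 1 / rho a"
  shows "Hfun a x powr (- (1 / a)) = x powr (- (1 / a)) * (1 / Lfun a x powr (1 / (1 + a)))"
proof -
  let ?K = "Lfun a x powr (1 / (1 + a))"
  have K: "?K > 0" using Hfun_relations(1)[OF a x] by linarith
  have "Hfun a x powr (- (1 / a)) = x powr (- (1 / a)) * (?K powr a) powr (- (1 / a))"
    unfolding Hfun_relations(3)[OF a x] using x K by (intro powr_mult)
  also have "(?K powr a) powr (- (1 / a)) = 1 / ?K"
  proof -
    have "a * - (1 / a) = - 1" using a by simp
    then show ?thesis
      unfolding powr_powr[of ?K] using K by (simp only: powr_minus_divide powr_one less_imp_le)
  qed
  finally show ?thesis .
qed

text \<open>In logarithmic derivatives times x: 1 + (1 + a) e / a from o, minus e / a from the power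
  of L, leaves 1 + e.\<close>

lemma Hfun_has_derivative:
  assumes a: "1 / 2 < a" and x: "0 < x" "x < 1 / rho a"
  shows "(Hfun a has_real_derivative Hfun a x * (1 + Eser a x) / x) (at x)"
proof -
  let ?e = "Eser a x" and ?o = "Oser a x"
  have "(a * ?o + (1 + a) * (?e * ?o)) / (a * x) * P + - 1 * (P * ?e / (a * x)) * ?o = ?o * P * (1 + ?e) / x" for P
    using a x by (simp add: field_simps)
  from DERIV_mult[OF Oser_has_derivative[OF a x] Lfun_powr_has_derivative[OF a x, of 1], unfolded this] show ?thesis
    by (simp add: Hfun_def[abs_def])
qed

lemma Hfun_filterlim:
  assumes a: "1 / 2 < a"
  shows "filterlim (Hfun a) (at_right 0) (at_right 0)"
proof -
  obtain r where r: "0 < r" "r < 1 / rho a" using R_pos[OF a] by blast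
  have "(Hfun a \<longlongrightarrow> 0 * 1 powr (- (1 / (1 + a)))) (at_right 0)"
    unfolding Hfun_def[abs_def] by (intro tendsto_intros Oser_tendsto Lfun_tendsto a) auto
  moreover have "\<forall>\<^sub>F x in at_right 0. Hfun a x \<in> {0<..} \<and> Hfun a x \<noteq> 0"
    unfolding eventually_at_right_field using Hfun_relations(4)[OF a] r
    by (intro exI[of _ r]) (auto, metis less_irrefl order_less_trans)
  ultimately show ?thesis by (simp add: filterlim_at)
qed

lemma Phi_Hfun:
  assumes a: "1 / 2 < a" and x: "0 < x" "x < 1 / rho a"
  shows "Phi (1 / a) (Hfun a x) = x powr (- (1 / a))"
proof -
  note s = inverse_range[OF a]
  have "Phi (1 / a) (Hfun a x) - x powr (- (1 / a)) = 0"
  proof (rule has_zero_derivative_eq_limit[OF _ _ x])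
    fix x assume x: "0 < x" "x < 1 / rho a"
    let ?K = "Lfun a x powr (1 / (1 + a))" and ?H = "Hfun a x"
    note rel = Hfun_relations[OF a x]
    let ?q = "sqrt (1 + ?H\<^sup>2)"
    have q: "?q > 0" by (simp add: add_pos_nonneg)
    have K: "?K > 0" using rel(1) by linarith
    have d: "((\<lambda>x. Phi (1 / a) (Hfun a x) - x powr (- (1 / a))) has_real_derivative
       - (1 / a * ?H powr (- (1 / a) - 1) / ?q) * (?H * (1 + Eser a x) / x)
         - - (1 / a) * x powr (- (1 / a) - 1)) (at x)"
      by (intro DERIV_diff DERIV_chain2[OF Phi_has_derivative[OF s rel(4)] Hfun_has_derivative[OF a x]]
        has_real_derivative_powr x)
    have "?H powr (- (1 / a) - 1) = ?H powr (- (1 / a)) / ?H"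
      using rel(4) by (simp add: powr_diff)
    also note Hfun_powr[OF a x]
    finally have e1: "?H powr (- (1 / a) - 1) = x powr (- (1 / a)) * (1 / ?K) / ?H" .
    have e2: "x powr (- (1 / a) - 1) = x powr (- (1 / a)) / x" using x by (simp add: powr_diff)
    have "- (1 / a * (p * (1 / k) / h) / q) * (h * (k * q) / x) - - (1 / a) * (p / x) = 0"
      if "k > 0" "h > 0" "q > 0" for k h q p :: real
      using that x a by (simp add: field_simps)
    from d[unfolded e1 e2 rel(6) this[OF K rel(4) q]]
    show "((\<lambda>x. Phi (1 / a) (Hfun a x) - x powr (- (1 / a))) has_real_derivative 0) (at x)" .
  next
    obtain r where r: "0 < r" "r < 1 / rho a" using R_pos[OF a] by blast
    let ?C = "(Oser a r - r) / r ^ 3"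
    \<comment> \<open>Both H^(-1/a) and x^(-1/a) diverge, so K tending to 1 is too weak. Their
      difference is x^(-1/a) (1/K - 1), and 0 \<le> K - 1 \<le> L - 1 = O(x^2) makes it
      O(x^(2-1/a)).\<close>
    have "((\<lambda>x. Hfun a x powr (- (1 / a)) - x powr (- (1 / a))) \<longlongrightarrow> 0) (at_right 0)"
    proof (rule Lim_null_comparison)
      show "\<forall>\<^sub>F x in at_right 0. norm (Hfun a x powr (- (1 / a)) - x powr (- (1 / a)))
          \<le> x powr (2 - 1 / a) * ?C"
        unfolding eventually_at_right_field
      proof (intro exI[of _ r] conjI allI impI r)
        fix x assume x: "0 < x" "x < r"
        then have xR: "0 < x" "x < 1 / rho a" using r by auto
        let ?K = "Lfun a x powr (1 / (1 + a))"
        note rel = Hfun_relations[OF a xR]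
        have "norm (Hfun a x powr (- (1 / a)) - x powr (- (1 / a)))
            = \<bar>x powr (- (1 / a)) * (1 / ?K - 1)\<bar>"
          unfolding Hfun_powr[OF a xR] by (simp add: right_diff_distrib)
        also have "\<dots> = x powr (- (1 / a)) * \<bar>1 / ?K - 1\<bar>" by (simp add: abs_mult)
        also have "\<bar>1 / ?K - 1\<bar> \<le> x\<^sup>2 * ?C"
        proof -
          have "\<bar>1 / k - 1\<bar> \<le> k - 1" if "k \<ge> 1" for k :: real
          proof -
            have "\<bar>1 / k - 1\<bar> = (k - 1) / k" using that by (simp add: field_simps)
            also have "\<dots> \<le> (k - 1) / 1" using that by (intro divide_left_mono) auto
            finally show ?thesis by simp
          qed
          from this[OF rel(1)] rel(2) Lfun_le[OF a xR(1) less_imp_le[OF x(2)] r(2)]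
          show ?thesis by linarith
        qed
        also have "x powr (- (1 / a)) * (x\<^sup>2 * ?C) = x powr (2 - 1 / a) * ?C"
          using x by (simp add: powr_diff powr_minus field_simps)
        finally show "norm (Hfun a x powr (- (1 / a)) - x powr (- (1 / a))) \<le> x powr (2 - 1 / a) * ?C"
          by (simp add: mult_left_mono)
      qed
      have "((\<lambda>x. x powr (2 - 1 / a)) \<longlongrightarrow> 0) (at_right 0)" using s by real_asymp
      then show "((\<lambda>x. x powr (2 - 1 / a) * ?C) \<longlongrightarrow> 0) (at_right 0)"
        by (rule tendsto_mult_left_zero)
    qed
    from tendsto_add[OF filterlim_compose[OF Phi_asymp_0[OF s] Hfun_filterlim[OF a]] this]
    show "((\<lambda>x. Phi (1 / a) (Hfun a x) - x powr (- (1 / a))) \<longlongrightarrow> 0) (at_right 0)" by simp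
  qed
  then show ?thesis by simp
qed

text \<open>Summability is part of the conclusion, so that the value of \<open>M\<close> is that of
  a convergent series.\<close>

theorem proposition3p2:
  fixes a x :: real
  assumes "a \<in> {1 / 2 <..< 1}"
    and "x \<in> {0 <..< 1 / rho a}"
  shows "summable (\<lambda>n. m a n * x ^ n) \<and>
    M a x = (G a x / x) powr (1 / a) * (G a x + sqrt (1 + (G a x)\<^sup>2))"
proof -
  have a: "1 / 2 < a" and x: "0 < x" "x < 1 / rho a" using assms by auto
  note rel = Hfun_relations[OF a x]
  let ?K = "Lfun a x powr (1 / (1 + a))"
  have K: "?K > 0" using rel(1) by linarith
  have G: "G a x = Hfun a x"
    by (rule G_eqI[OF a rel(4)]) (simp add: Phi_Hfun[OF a x])
  \<comment> \<open>Since H / x = K^a, the power 1/a returns K, the common factor of 1 + e and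
    o.\<close>
  have "(G a x / x) powr (1 / a) = (?K powr a) powr (1 / a)"
    unfolding G rel(3) using x by simp
  also have "\<dots> = ?K powr 1" unfolding powr_powr[of ?K] using a by simp
  also have "\<dots> = ?K" using K by (intro powr_one less_imp_le)
  finally have "(G a x / x) powr (1 / a) * (G a x + sqrt (1 + (G a x)\<^sup>2)) = ?K * Hfun a x + ?K * sqrt (1 + (Hfun a x)\<^sup>2)"
    unfolding G by (simp add: distrib_left)
  then show ?thesis
    using M_eq_Eser_Oser[OF a x] rel(5,6) by simp
qed

end
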